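(* Fix a budget of $K\ge 2$ return samples per advantage estimate. Let $$A^{\mathrm{GRPO}}_k=G^{(k)}-\frac1{K-1}\sum_{j\ne k}G^{(j)}$$ be the leave-one-out trajectory-level advantage, where $G^{(1)},\dots,G^{(K)}$ are the returns of $K$ independent rollouts of the policy $\pi$ from the initial state $s_0$. Let $A^{\mathrm{BPO}}_k$ be the sibling-baseline advantage at a branch point $t>0$, with $K$ siblings sharing the prefix $\tau_{0:t}$. Then $$\mathrm{Var}\left(A^{\mathrm{BPO}}_k\mid s_0\right)=\mathrm{Var}\left(A^{\mathrm{GRPO}}_k\mid s_0\right)-\frac{K}{K-1}\,\mathrm{Var}_{\tau_{0:t}\mid s_0}\left(V^\pi(s_t)\right).$$ In particular, $\mathrm{Var}(A^{\mathrm{BPO}}_k\mid s_0)\le \mathrm{Var}(A^{\mathrm{GRPO}}_k\mid s_0)$, with equality if and only if $V^\pi(s_t)$ is constant in $\tau_{0:t}$.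
   Context: Setting: an episodic Markov decision process with states $s$, actions $a$, a transition kernel, rewards $r_t$, discount $\gamma$, and a given initial state $s_0$; $\pi$ is a stochastic policy. The return of a trajectory is $\sum_{t=0}^T\gamma^t r_t$ and the return-to-go from step $t$ is $G_t=\sum_{t'\ge t}\gamma^{t'-t}r_{t'}$. Rewards are described as sparse: typically $r_t=0$ for $t<T$ and $r_T\in\{0,1\}$ at termination. $V^\pi(s_t)$ is the expected return from $s_t$ under $\pi$. Sibling-baseline advantage at branch point $t$: a prefix $\tau_{0:t}$ ending in the state $s_t$ is sampled from $s_0$ under $\pi$. The environment can be restored to $s_t$ with identical transition distribution, so that, given $s_t$, $K$ actions are drawn i.i.d. from $\pi(\cdot\mid s_t)$ and each is rolled out independently to termination under $\pi$, giving returns-to-go $G_t^{(t,1)},\dots,G_t^{(t,K)}$. Then $$A^{\mathrm{BPO}}_k=G_t^{(t,k)}-\frac1{K-1}\sum_{j\ne k}G_t^{(t,j)}.$$ $\mathrm{Var}_{\tau_{0:t}\mid s_0}$ denotes variance over the random prefix $\tau_{0:t}$ given $s_0$.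
   Formalization: The claim fails for γ<1 or random rewards before t; proved for γ=1 with zero rewards before the branch point, branch point a.s. before termination, a.s. terminating episodes, square-integrable return, and "constant" read as almost surely constant. *)

theory Defs
  imports "HOL-Probability.Probability"
begin

text \<open>
  State and action spaces are arbitrary measurable spaces. The kernel gives the joint law of the
  reward \<open>r\<^sub>i\<close> and the next state \<open>s\<^sub>i\<^sub>+\<^sub>1\<close> given \<open>(s\<^sub>i, a\<^sub>i)\<close>; this covers rewards that are
  functions of \<open>(s\<^sub>i, a\<^sub>i, s\<^sub>i\<^sub>+\<^sub>1)\<close> as well as random rewards. An episode ends on its first visit to
  \<open>terminal\<close>; what the kernel does from a terminal state is irrelevant, because nothing
  after that visit enters a return.
\<close>

record ('s, 'a) mdp =
  states :: "'s measure"
  actions :: "'a measure"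
  kernel :: "'s \<times> 'a \<Rightarrow> (real \<times> 's) measure"
  terminal :: "'s set"
  discount :: real

definition is_mdp :: "('s, 'a) mdp \<Rightarrow> bool" where
  "is_mdp M \<longleftrightarrow>
     kernel M \<in> states M \<Otimes>\<^sub>M actions M \<rightarrow>\<^sub>M prob_algebra (borel \<Otimes>\<^sub>M states M) \<and>
     terminal M \<in> sets (states M) \<and> 0 \<le> discount M \<and> discount M \<le> 1"

definition is_policy :: "('s, 'a) mdp \<Rightarrow> ('s \<Rightarrow> 'a measure) \<Rightarrow> bool" where
  "is_policy M \<pi> \<longleftrightarrow> \<pi> \<in> states M \<rightarrow>\<^sub>M prob_algebra (actions M)"

text \<open>
  A trajectory from a given state \<open>s\<close> is the sequence \<open>\<omega>\<close> with \<open>\<omega> i = (a\<^sub>i, r\<^sub>i, s\<^sub>i\<^sub>+\<^sub>1)\<close>;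
  the initial state \<open>s\<^sub>0 = s\<close> is kept as a separate parameter.
\<close>

type_synonym ('s, 'a) trajectory = "nat \<Rightarrow> 'a \<times> real \<times> 's"

definition state_at :: "'s \<Rightarrow> ('s, 'a) trajectory \<Rightarrow> nat \<Rightarrow> 's" where
  "state_at s \<omega> n = (case n of 0 \<Rightarrow> s | Suc m \<Rightarrow> snd (snd (\<omega> m)))"

definition reward_at :: "('s, 'a) trajectory \<Rightarrow> nat \<Rightarrow> real" where
  "reward_at \<omega> n = fst (snd (\<omega> n))"

definition step_space :: "('s, 'a) mdp \<Rightarrow> ('a \<times> real \<times> 's) measure" where
  "step_space M = actions M \<Otimes>\<^sub>M borel \<Otimes>\<^sub>M states M"

definition step_law :: "('s, 'a) mdp \<Rightarrow> ('s \<Rightarrow> 'a measure) \<Rightarrow> 's \<Rightarrow> ('a \<times> real \<times> 's) measure" where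
  "step_law M \<pi> s = \<pi> s \<bind> (\<lambda>a. distr (kernel M (s, a)) (step_space M) (\<lambda>(r, s'). (a, r, s')))"

text \<open>
  The law of a rollout of \<open>\<pi>\<close> started in \<open>s\<close> is the Ionescu-Tulcea limit of the steps; this term
  is what \<open>PF.lim\<close> abbreviates inside the locale.
\<close>

definition rollout :: "('s, 'a) mdp \<Rightarrow> ('s \<Rightarrow> 'a measure) \<Rightarrow> 's \<Rightarrow> ('s, 'a) trajectory measure" where
  "rollout M \<pi> s =
     projective_family.lim UNIV
       (Ionescu_Tulcea.CI (\<lambda>i \<omega>. step_law M \<pi> (state_at s \<omega> i)) (\<lambda>_. step_space M))
       (\<lambda>_. step_space M)"

definition terminates :: "('s, 'a) mdp \<Rightarrow> 's \<Rightarrow> ('s, 'a) trajectory \<Rightarrow> bool" where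
  "terminates M s \<omega> \<longleftrightarrow> (\<exists>n. state_at s \<omega> n \<in> terminal M)"

text \<open>
  The number of steps of the episode, that is \<open>T + 1\<close> where \<open>T\<close> is the time of the last reward.
  It is meaningful only if the episode terminates.
\<close>

definition episode_length :: "('s, 'a) mdp \<Rightarrow> 's \<Rightarrow> ('s, 'a) trajectory \<Rightarrow> nat" where
  "episode_length M s \<omega> = (LEAST n. state_at s \<omega> n \<in> terminal M)"

definition total_return :: "('s, 'a) mdp \<Rightarrow> 's \<Rightarrow> ('s, 'a) trajectory \<Rightarrow> real" where
  "total_return M s \<omega> = (\<Sum>i<episode_length M s \<omega>. discount M ^ i * reward_at \<omega> i)"

definition return_to_go :: "('s, 'a) mdp \<Rightarrow> 's \<Rightarrow> nat \<Rightarrow> ('s, 'a) trajectory \<Rightarrow> real" where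
  "return_to_go M s t \<omega> = (\<Sum>i\<in>{t..<episode_length M s \<omega>}. discount M ^ (i - t) * reward_at \<omega> i)"

definition state_value :: "('s, 'a) mdp \<Rightarrow> ('s \<Rightarrow> 'a measure) \<Rightarrow> 's \<Rightarrow> real" where
  "state_value M \<pi> s = (\<integral>\<omega>. total_return M s \<omega> \<partial>rollout M \<pi> s)"

definition leave_one_out :: "nat \<Rightarrow> (nat \<Rightarrow> real) \<Rightarrow> nat \<Rightarrow> real" where
  "leave_one_out K g k = g k - 1 / (real K - 1) * (\<Sum>j\<in>{1..K} - {k}. g j)"

definition grpo_law ::
  "('s, 'a) mdp \<Rightarrow> ('s \<Rightarrow> 'a measure) \<Rightarrow> nat \<Rightarrow> 's \<Rightarrow> (nat \<Rightarrow> ('s, 'a) trajectory) measure" where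
  "grpo_law M \<pi> K s = (\<Pi>\<^sub>M k\<in>{1..K}. rollout M \<pi> s)"

definition grpo_advantage ::
  "('s, 'a) mdp \<Rightarrow> nat \<Rightarrow> 's \<Rightarrow> nat \<Rightarrow> (nat \<Rightarrow> ('s, 'a) trajectory) \<Rightarrow> real" where
  "grpo_advantage M K s k x = leave_one_out K (\<lambda>j. total_return M s (x j)) k"

definition prefix_space :: "('s, 'a) mdp \<Rightarrow> nat \<Rightarrow> ('s, 'a) trajectory measure" where
  "prefix_space M t = (\<Pi>\<^sub>M i\<in>{0..<t}. step_space M)"

text \<open>A prefix records the steps before time \<open>t\<close>, so it determines \<open>s\<^sub>t\<close> as \<open>state_at s h t\<close>.\<close>

definition prefix_law ::
  "('s, 'a) mdp \<Rightarrow> ('s \<Rightarrow> 'a measure) \<Rightarrow> nat \<Rightarrow> 's \<Rightarrow> ('s, 'a) trajectory measure" where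
  "prefix_law M \<pi> t s = distr (rollout M \<pi> s) (prefix_space M t) (\<lambda>\<omega>. restrict \<omega> {0..<t})"

text \<open>
  Joint law of a prefix \<open>h\<close> and its \<open>K\<close> sibling continuations. The continuations are conditionally
  independent rollouts from \<open>s\<^sub>t\<close>, so their first actions are i.i.d. draws from \<open>\<pi> s\<^sub>t\<close>.
\<close>

definition bpo_law ::
  "('s, 'a) mdp \<Rightarrow> ('s \<Rightarrow> 'a measure) \<Rightarrow> nat \<Rightarrow> nat \<Rightarrow> 's \<Rightarrow>
     (('s, 'a) trajectory \<times> (nat \<Rightarrow> ('s, 'a) trajectory)) measure" where
  "bpo_law M \<pi> K t s =
     prefix_law M \<pi> t s \<bind>
       (\<lambda>h. distr (\<Pi>\<^sub>M k\<in>{1..K}. rollout M \<pi> (state_at s h t))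
              (prefix_space M t \<Otimes>\<^sub>M (\<Pi>\<^sub>M k\<in>{1..K}. \<Pi>\<^sub>M i\<in>UNIV. step_space M))
              (\<lambda>x. (h, x)))"

text \<open>Note that \<open>comb_seq t h \<omega>\<close> is the full trajectory: the prefix \<open>h\<close> up to time \<open>t\<close>, then \<open>\<omega>\<close>.\<close>

definition bpo_advantage ::
  "('s, 'a) mdp \<Rightarrow> nat \<Rightarrow> nat \<Rightarrow> 's \<Rightarrow> nat \<Rightarrow>
     ('s, 'a) trajectory \<times> (nat \<Rightarrow> ('s, 'a) trajectory) \<Rightarrow> real" where
  "bpo_advantage M K t s k =
     (\<lambda>(h, x). leave_one_out K (\<lambda>j. return_to_go M s t (comb_seq t h (x j))) k)"

end

theory Submission
  imports Defs
begin

text \<open>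
  By the Markov property of the Ionescu-Tulcea rollout, a rollout from \<open>s\<^sub>0\<close> is a random prefix
  \<open>h\<close> followed by a fresh rollout from \<open>s\<^sub>t\<close>. With rewards vanishing before \<open>t\<close> and no
  discounting, the return of the whole trajectory is the return-to-go, whose conditional mean
  given \<open>h\<close> is \<open>V\<^sup>\<pi> s\<^sub>t\<close>. A leave-one-out combination of \<open>K\<close> i.i.d. samples has mean \<open>0\<close> and
  variance \<open>K / (K - 1)\<close> times the variance of one sample. For independent rollouts this is the total
  variance of the return; for siblings it is only the expected conditional variance given \<open>h\<close>,
  and the law of total variance identifies the difference as the variance of \<open>V\<^sup>\<pi> s\<^sub>t\<close>.
\<close>

subsection \<open>Kernels and variances\<close>

text \<open>Fubini for kernels and unbounded signed \<open>f\<close>. The positive and negative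
  parts obey \<open>nn_integral_bind\<close> separately. Both iterated integrals are finite, so both
  inner integrals are finite for almost every \<open>x\<close>, and their difference is the Bochner
  integral.\<close>

lemma integrable_kernel_bind:
  fixes f :: "'b \<Rightarrow> real"
  assumes "prob_space M" and K[measurable]: "K \<in> M \<rightarrow>\<^sub>M subprob_algebra N"
    and f: "integrable (M \<bind> K) f"
  shows AE_integrable_kernel: "AE x in M. integrable (K x) f"
    and integrable_integral_kernel: "integrable M (\<lambda>x. \<integral>y. f y \<partial>K x)"
    and integral_kernel_bind: "(\<integral>y. f y \<partial>(M \<bind> K)) = (\<integral>x. (\<integral>y. f y \<partial>K x) \<partial>M)"
proof -
  interpret prob_space M by fact
  have sets: "sets (M \<bind> K) = sets N"
    by (rule sets_bind[OF sets_kernel[OF K] not_empty])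
  have fN[measurable]: "f \<in> borel_measurable N"
    using borel_measurable_integrable[OF f] by (simp add: measurable_cong_sets[OF sets refl])
  \<comment> \<open>The sign \<open>s = 1\<close> selects the positive part of \<open>f\<close> and
    \<open>s = -1\<close> the negative part, since \<open>ennreal\<close> sends negative reals to
    0.\<close>
  have nn: "(\<integral>\<^sup>+x. \<integral>\<^sup>+y. ennreal (s * f y) \<partial>K x \<partial>M) < \<infinity>" if "s \<in> {1, -1}" for s
  proof -
    have "(\<integral>\<^sup>+y. ennreal (s * f y) \<partial>(M \<bind> K)) \<le> (\<integral>\<^sup>+y. norm (f y) \<partial>(M \<bind> K))"
      using that by (intro nn_integral_mono) (auto intro!: ennreal_leI)
    also have "\<dots> < \<infinity>" using f by (simp add: integrable_iff_bounded)
    finally show ?thesis by (subst (asm) nn_integral_bind[where B=N]) auto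
  qed
  have M[measurable]: "(\<lambda>x. \<integral>\<^sup>+y. ennreal (s * f y) \<partial>K x) \<in> borel_measurable M" for s
    by (rule measurable_compose[OF K nn_integral_measurable_subprob_algebra]) measurable
  have fin: "AE x in M. (\<integral>\<^sup>+y. ennreal (s * f y) \<partial>K x) \<noteq> \<infinity>" if "s \<in> {1, -1}" for s
    using nn[OF that] by (intro nn_integral_noteq_infinite) auto
  have meas: "f \<in> borel_measurable (K x)" if "x \<in> space M" for x
    using fN unfolding subprob_measurableD(3)[OF K that] .
  show *: "AE x in M. integrable (K x) f"
    using fin[of 1, OF insertI1] fin[of "-1", OF insertI2[OF insertI1]] AE_space by eventually_elim (auto simp: real_integrable_def meas)
  \<comment> \<open>\<open>enn2real\<close> sends infinity to 0, so \<open>u\<close> is guaranteed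
    to represent the inner integral only where that is finite, hence almost everywhere.\<close>
  define u where "u s x = enn2real (\<integral>\<^sup>+y. ennreal (s * f y) \<partial>K x)" for s x
  have [measurable]: "u s \<in> borel_measurable M" for s unfolding u_def by measurable
  have eu: "AE x in M. (\<integral>\<^sup>+y. ennreal (s * f y) \<partial>K x) = ennreal (u s x)" if "s \<in> {1, -1}" for s
    using fin[OF that] by eventually_elim (auto simp: u_def less_top)
  have nnu: "(\<integral>\<^sup>+x. \<integral>\<^sup>+y. ennreal (s * f y) \<partial>K x \<partial>M) = (\<integral>\<^sup>+x. ennreal (u s x) \<partial>M)" if "s \<in> {1, -1}" for s
    by (rule nn_integral_cong_AE[OF eu[OF that]])
  have iu: "integrable M (u s)" if "s \<in> {1, -1}" for s
    using nn[OF that] nnu[OF that] by (intro integrableI_nonneg) (auto simp: u_def)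
  have iu': "(\<integral>x. u s x \<partial>M) = enn2real (\<integral>\<^sup>+x. \<integral>\<^sup>+y. ennreal (s * f y) \<partial>K x \<partial>M)" if "s \<in> {1, -1}" for s
    unfolding nnu[OF that] by (rule integral_eq_nn_integral) (auto simp: u_def)
  have Ku: "AE x in M. (\<integral>y. f y \<partial>K x) = u 1 x - u (-1) x"
    using * by eventually_elim (simp add: real_lebesgue_integral_def u_def)
  have Km[measurable]: "(\<lambda>x. \<integral>y. f y \<partial>K x) \<in> borel_measurable M"
    by (rule measurable_compose[OF K integral_measurable_subprob_algebra]) measurable
  show "integrable M (\<lambda>x. \<integral>y. f y \<partial>K x)"
    by (rule integrable_cong_AE[THEN iffD2, OF _ _ Ku]) (use iu in auto)
  have "(\<integral>x. (\<integral>y. f y \<partial>K x) \<partial>M) = (\<integral>x. u 1 x - u (-1) x \<partial>M)"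
    by (rule integral_cong_AE[OF _ _ Ku]) auto
  also have "\<dots> = (\<integral>x. u 1 x \<partial>M) - (\<integral>x. u (-1) x \<partial>M)"
    by (rule Bochner_Integration.integral_diff) (auto intro: iu)
  also have "\<dots> = (\<integral>y. f y \<partial>(M \<bind> K))"
    unfolding real_lebesgue_integral_def[OF f] by (simp add: iu' nn_integral_bind[where B=N])
  finally show "(\<integral>y. f y \<partial>(M \<bind> K)) = (\<integral>x. (\<integral>y. f y \<partial>K x) \<partial>M)" ..
qed

text \<open>Each of the three variances is a second moment minus a squared mean, and the integrals
  of the squared conditional mean cancel. For the conditional variance this formula is available
  where \<open>f\<close> and its square are integrable under \<open>K x\<close>, which is why the
  argument runs through almost-everywhere equalities.\<close>

lemma law_of_total_variance:
  fixes f :: "'b \<Rightarrow> real"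
  assumes "prob_space M" and K: "K \<in> M \<rightarrow>\<^sub>M prob_algebra N"
    and f[measurable]: "f \<in> borel_measurable N" and f2: "integrable (M \<bind> K) (\<lambda>y. (f y)\<^sup>2)"
  shows "AE x in M. integrable (K x) (\<lambda>y. (f y)\<^sup>2)"
    and "integrable M (\<lambda>x. \<integral>y. f y \<partial>K x)"
    and "integrable M (\<lambda>x. (\<integral>y. f y \<partial>K x)\<^sup>2)"
    and "integrable M (\<lambda>x. prob_space.variance (K x) f)"
    and "prob_space.variance (M \<bind> K) f =
           (\<integral>x. prob_space.variance (K x) f \<partial>M) +
           prob_space.variance M (\<lambda>x. \<integral>y. f y \<partial>K x)"
proof -
  interpret prob_space M by fact
  note Ks[measurable] = measurable_prob_algebraD[OF K]
  have pK: "prob_space (K x)" and sK: "sets (K x) = sets N" if "x \<in> space M" for x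
    using measurable_space[OF K that] by (auto simp: space_prob_algebra)
  interpret B: prob_space "M \<bind> K"
    by (rule prob_space_bind[OF AE_I2 Ks]) (rule pK)
  have [measurable_cong]: "sets (M \<bind> K) = sets N"
    by (rule sets_bind[OF sets_kernel[OF Ks] not_empty])
  have f1: "integrable (M \<bind> K) f"
    by (rule B.square_integrable_imp_integrable[OF _ f2]) measurable
  note k1 = integrable_kernel_bind[OF \<open>prob_space M\<close> Ks f1]
  note k2 = integrable_kernel_bind[OF \<open>prob_space M\<close> Ks f2]
  show "AE x in M. integrable (K x) (\<lambda>y. (f y)\<^sup>2)" by (rule k2(1))
  show "integrable M (\<lambda>x. \<integral>y. f y \<partial>K x)" by (rule k1(2))
  have var: "AE x in M. prob_space.variance (K x) f = (\<integral>y. (f y)\<^sup>2 \<partial>K x) - (\<integral>y. f y \<partial>K x)\<^sup>2"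
    using k1(1) k2(1) AE_space by eventually_elim (rule prob_space.variance_eq[OF pK])
  have mm[measurable]: "(\<lambda>x. \<integral>y. f y \<partial>K x) \<in> borel_measurable M"
    using k1(2) by auto
  \<comment> \<open>Nonnegativity of the conditional variance bounds the squared conditional mean by
    the conditional second moment, which is integrable.\<close>
  show sq: "integrable M (\<lambda>x. (\<integral>y. f y \<partial>K x)\<^sup>2)"
  proof (rule Bochner_Integration.integrable_bound[OF k2(2)])
    show "AE x in M. norm ((\<integral>y. f y \<partial>K x)\<^sup>2) \<le> norm (\<integral>y. (f y)\<^sup>2 \<partial>K x)"
      using var AE_space
    proof eventually_elim
      case (elim x)
      have "0 \<le> prob_space.variance (K x) f" by (rule prob_space.variance_positive[OF pK[OF elim(2)]])
      with elim show ?case by auto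
    qed
  qed measurable
  \<comment> \<open>The integrand itself depends on \<open>x\<close> through the conditional mean.
    Pushing \<open>K x\<close> forward along it gives a kernel into the real line, whose mean is
    measurable in \<open>x\<close>.\<close>
  have vm[measurable]: "(\<lambda>x. prob_space.variance (K x) f) \<in> borel_measurable M"
  proof -
    have "(\<lambda>(x, y). (f y - (\<integral>z. f z \<partial>K x))\<^sup>2) \<in> borel_measurable (M \<Otimes>\<^sub>M N)"
      by measurable
    from measurable_compose[OF measurable_distr2[OF _ Ks, of "\<lambda>x y. (f y - (\<integral>z. f z \<partial>K x))\<^sup>2" borel]
        integral_measurable_subprob_algebra[of "\<lambda>x. x"]] this
    have "(\<lambda>x. \<integral>z. z \<partial>(distr (K x) borel (\<lambda>y. (f y - (\<integral>z. f z \<partial>K x))\<^sup>2))) \<in> borel_measurable M"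
      by auto
    also have "?this \<longleftrightarrow> ?thesis"
      by (intro measurable_cong) (auto simp: integral_distr measurable_cong_sets[OF sK refl])
    finally show ?thesis .
  qed
  have iv: "integrable M (\<lambda>x. (\<integral>y. (f y)\<^sup>2 \<partial>K x) - (\<integral>y. f y \<partial>K x)\<^sup>2)"
    using k2(2) sq by auto
  show "integrable M (\<lambda>x. prob_space.variance (K x) f)"
    by (rule integrable_cong_AE[THEN iffD2, OF _ _ var iv]) (use iv in auto)
  have "(\<integral>x. prob_space.variance (K x) f \<partial>M) = (\<integral>x. (\<integral>y. (f y)\<^sup>2 \<partial>K x) - (\<integral>y. f y \<partial>K x)\<^sup>2 \<partial>M)"
    by (rule integral_cong_AE[OF _ _ var]) (use iv in auto)
  also have "\<dots> = B.expectation (\<lambda>y. (f y)\<^sup>2) - expectation (\<lambda>x. (\<integral>y. f y \<partial>K x)\<^sup>2)"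
    using k2 sq by simp
  finally show "prob_space.variance (M \<bind> K) f =
           (\<integral>x. prob_space.variance (K x) f \<partial>M) +
           prob_space.variance M (\<lambda>x. \<integral>y. f y \<partial>K x)"
    using B.variance_eq[OF f1 f2] variance_eq[OF k1(2) sq] k1(3) by simp
qed

text \<open>A nonnegative integrable function with zero integral vanishes almost everywhere; this is
  applied to the squared deviation from the mean. Conversely, an almost sure constant value must be
  the mean.\<close>

lemma (in prob_space) variance_zero_iff_AE_const:
  fixes X :: "'a \<Rightarrow> real"
  assumes X: "integrable M X" "integrable M (\<lambda>x. (X x)\<^sup>2)"
  shows "variance X = 0 \<longleftrightarrow> (\<exists>c. AE x in M. X x = c)"
proof -
  have i: "integrable M (\<lambda>x. (X x - expectation X)\<^sup>2)"
    using X by (simp add: power2_diff)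
  have eq: "variance X = 0 \<longleftrightarrow> (AE x in M. X x = expectation X)"
    by (subst integral_nonneg_eq_0_iff_AE[OF i]) auto
  show ?thesis
  proof
    assume "\<exists>c. AE x in M. X x = c"
    then obtain c where c: "AE x in M. X x = c" ..
    have "expectation X = expectation (\<lambda>_. c)"
      by (rule integral_cong_AE) (use X c in auto)
    with c eq show "variance X = 0" by (simp add: prob_space)
  qed (use eq in auto)
qed

section \<open>Moments of leave-one-out combinations of i.i.d. samples\<close>

lemma integral_PiM_component:
  fixes f :: "'a \<Rightarrow> real"
  assumes "\<And>i. i \<in> I \<Longrightarrow> prob_space (N i)" "i \<in> I" "f \<in> borel_measurable (N i)"
  shows "(\<integral>x. f (x i) \<partial>Pi\<^sub>M I N) = (\<integral>y. f y \<partial>N i)"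
    and "integrable (Pi\<^sub>M I N) (\<lambda>x. f (x i)) \<longleftrightarrow> integrable (N i) f"
  using integral_distr[of "\<lambda>x. x i" "Pi\<^sub>M I N" "N i" f]
    integrable_distr_eq[of "\<lambda>x. x i" "Pi\<^sub>M I N" "N i" f] assms
  by (auto simp: distr_PiM_component)

text \<open>Independence of distinct coordinates: the product formula over all of \<open>I\<close>,
  with the constant factor 1 at every coordinate other than \<open>i\<close> and
  \<open>j\<close>.\<close>

lemma integral_PiM_two_components:
  fixes f g :: "'a \<Rightarrow> real"
  assumes "prob_space N" "finite I" "i \<in> I" "j \<in> I" "i \<noteq> j" "integrable N f" "integrable N g"
  shows "(\<integral>x. f (x i) * g (x j) \<partial>(\<Pi>\<^sub>M i\<in>I. N)) = (\<integral>y. f y \<partial>N) * (\<integral>y. g y \<partial>N)"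
    and "integrable (\<Pi>\<^sub>M i\<in>I. N) (\<lambda>x. f (x i) * g (x j))"
proof -
  interpret N: prob_space N by fact
  interpret product_prob_space "\<lambda>_. N" I ..
  define h where "h m = (if m = i then f else if m = j then g else (\<lambda>_. 1))" for m
  have ih: "integrable N (h m)" for m using assms by (simp add: h_def)
  have e: "(\<Prod>m\<in>I. u m) = u i * u j" if "\<And>m. m \<noteq> i \<Longrightarrow> m \<noteq> j \<Longrightarrow> u m = 1" for u :: "_ \<Rightarrow> real"
    using assms that prod.mono_neutral_right[of I "{i, j}" u] by auto
  have 1: "(\<Prod>m\<in>I. h m (x m)) = f (x i) * g (x j)" for x
    using assms by (subst e) (auto simp: h_def)
  have 2: "(\<Prod>m\<in>I. integral\<^sup>L N (h m)) = (\<integral>y. f y \<partial>N) * (\<integral>y. g y \<partial>N)"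
    using assms by (subst e) (auto simp: h_def N.prob_space)
  show "(\<integral>x. f (x i) * g (x j) \<partial>(\<Pi>\<^sub>M i\<in>I. N)) = (\<integral>y. f y \<partial>N) * (\<integral>y. g y \<partial>N)"
    using product_integral_prod[of I h] assms ih by (simp add: 1 2)
  show "integrable (\<Pi>\<^sub>M i\<in>I. N) (\<lambda>x. f (x i) * g (x j))"
    using product_integrable_prod[of I h] assms ih by (simp add: 1)
qed

text \<open>The coefficients \<open>c\<close>, equal to 1 at \<open>k\<close> and to -1/(K-1)
  elsewhere, sum to zero, so \<open>g\<close> may be replaced by its centred version
  \<open>d\<close>. Independence kills the mixed products, and the diagonal contributes the variance
  of \<open>g\<close> times 1 + 1/(K-1) = K/(K-1).\<close>

lemma leave_one_out_moments:
  fixes g :: "'a \<Rightarrow> real"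
  assumes "prob_space N" and g: "g \<in> borel_measurable N" "integrable N (\<lambda>y. (g y)\<^sup>2)"
    and K: "K \<ge> 2" and k: "k \<in> {1..K}"
  defines "A \<equiv> \<lambda>x. leave_one_out K (\<lambda>j. g (x j)) k"
  shows "(\<integral>x. A x \<partial>(\<Pi>\<^sub>M j\<in>{1..K}. N)) = 0"
    and "integrable (\<Pi>\<^sub>M j\<in>{1..K}. N) (\<lambda>x. (A x)\<^sup>2)"
    and "(\<integral>x. (A x)\<^sup>2 \<partial>(\<Pi>\<^sub>M j\<in>{1..K}. N)) = real K / (real K - 1) * prob_space.variance N g"
proof -
  define I where "I = {1..K}"
  let ?P = "\<Pi>\<^sub>M j\<in>I. N"
  have [simp]: "finite I" and kI: "k \<in> I" using k by (auto simp: I_def)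
  interpret N: prob_space N by fact
  define d where "d = (\<lambda>y. g y - N.expectation g)"
  have ig: "integrable N g" by (rule N.square_integrable_imp_integrable[OF g])
  have id: "integrable N d" "N.expectation d = 0" and id2: "integrable N (\<lambda>y. d y * d y)"
    using ig g by (auto simp: d_def N.prob_space power2_eq_square[symmetric] power2_diff)
  have dm: "d \<in> borel_measurable N" using id by auto
  define c where "c j = (if j = k then 1 else - 1 / (real K - 1))" for j
  have cK: "card (I - {k}) = K - 1" using k by (simp add: I_def)
  have sc: "(\<Sum>j\<in>I. c j) = 0"
    using K kI by (subst sum.remove[of _ k]) (auto simp: c_def cK of_nat_diff)
  have r: "real K - 1 > 0" "card (I - {k}) = real K - 1" using K unfolding cK by (auto simp: of_nat_diff)
  have "(\<Sum>j\<in>I. c j * c j) = 1 + (\<Sum>j\<in>I - {k}. 1 / (real K - 1) * (1 / (real K - 1)))"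
    using kI by (subst sum.remove[of _ k]) (auto simp: c_def intro!: sum.cong)
  also have "\<dots> = real K / (real K - 1)"
    using r by (simp add: divide_simps)
  finally have c2: "(\<Sum>j\<in>I. c j * c j) = real K / (real K - 1)" .
  have A0: "A x = g (x k) - 1 / (real K - 1) * (\<Sum>j\<in>I - {k}. g (x j))" for x
    by (simp only: A_def leave_one_out_def I_def)
  have A: "A x = (\<Sum>j\<in>I. c j * d (x j))" for x
  proof -
    have "(\<Sum>j\<in>I. c j * d (x j)) = (\<Sum>j\<in>I. c j * g (x j))"
      using sc by (simp add: d_def right_diff_distrib sum_subtractf sum_distrib_right[symmetric])
    also have "\<dots> = A x"
      using kI by (subst sum.remove[of _ k]) (auto simp: A0 c_def sum_distrib_left sum_negf)
    finally show ?thesis ..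
  qed
  note pc = integral_PiM_component[of I "\<lambda>_. N", OF \<open>prob_space N\<close>]
  have "(\<integral>x. A x \<partial>?P) = 0"
    unfolding A using id by (subst Bochner_Integration.integral_sum) (auto simp: pc dm)
  then show "(\<integral>x. A x \<partial>(\<Pi>\<^sub>M j\<in>{1..K}. N)) = 0" by (simp only: I_def)
  have A2: "(A x)\<^sup>2 = (\<Sum>i\<in>I. \<Sum>j\<in>I. c i * c j * (d (x i) * d (x j)))" for x
    unfolding A power2_eq_square sum_product by (intro sum.cong) (auto simp: algebra_simps)
  have int: "integrable ?P (\<lambda>x. d (x i) * d (x j))"
    and eq: "(\<integral>x. d (x i) * d (x j) \<partial>?P) = (if i = j then N.variance g else 0)"
    if "i \<in> I" "j \<in> I" for i j
  proof -
    have "integrable ?P (\<lambda>x. d (x i) * d (x j)) \<and>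
        (\<integral>x. d (x i) * d (x j) \<partial>?P) = (if i = j then N.variance g else 0)"
    proof (cases "i = j")
      case True
      then show ?thesis
        using that pc[of i "\<lambda>y. d y * d y"] dm id2 by (auto simp: d_def power2_eq_square)
    next
      case False
      then show ?thesis
        using integral_PiM_two_components[OF \<open>prob_space N\<close> _ that False id(1) id(1)] id by simp
    qed
    then show "integrable ?P (\<lambda>x. d (x i) * d (x j))"
      "(\<integral>x. d (x i) * d (x j) \<partial>?P) = (if i = j then N.variance g else 0)" by auto
  qed
  have "integrable ?P (\<lambda>x. (A x)\<^sup>2)"
    unfolding A2 by (intro Bochner_Integration.integrable_sum integrable_mult_right int)
  then show "integrable (\<Pi>\<^sub>M j\<in>{1..K}. N) (\<lambda>x. (A x)\<^sup>2)" by (simp only: I_def)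
  have "(\<integral>x. (A x)\<^sup>2 \<partial>?P) = (\<Sum>i\<in>I. \<Sum>j\<in>I. c i * c j * (if i = j then N.variance g else 0))"
    unfolding A2 by (simp add: int eq)
  also have "\<dots> = (\<Sum>i\<in>I. c i * c i * N.variance g)"
    by (intro sum.cong refl) (simp add: if_distrib[of "\<lambda>u. _ * u"] cong: if_cong)
  also have "\<dots> = real K / (real K - 1) * N.variance g"
    by (simp add: sum_distrib_right[symmetric] c2)
  finally show "(\<integral>x. (A x)\<^sup>2 \<partial>(\<Pi>\<^sub>M j\<in>{1..K}. N)) = real K / (real K - 1) * N.variance g"
    by (simp only: I_def)
qed

section \<open>Siblings over a random prefix\<close>

lemma measurable_PiM_prob_algebra:
  assumes L: "\<kappa> \<in> M \<rightarrow>\<^sub>M prob_algebra N" and "finite I"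
  shows "(\<lambda>x. \<Pi>\<^sub>M i\<in>I. \<kappa> x) \<in> M \<rightarrow>\<^sub>M prob_algebra (\<Pi>\<^sub>M i\<in>I. N)"
proof (rule measurable_prob_algebra_generated[OF sets_PiM Int_stable_prod_algebra prod_algebra_sets_into_space])
  have p: "prob_space (\<kappa> x)" and s: "sets (\<kappa> x) = sets N" if "x \<in> space M" for x
    using measurable_space[OF L that] by (auto simp: space_prob_algebra)
  show "prob_space (\<Pi>\<^sub>M i\<in>I. \<kappa> x)" if "x \<in> space M" for x
    by (intro prob_space_PiM p that)
  show "sets (\<Pi>\<^sub>M i\<in>I. \<kappa> x) = sets (\<Pi>\<^sub>M i\<in>I. N)" if "x \<in> space M" for x
    by (intro sets_PiM_cong refl s that)
  fix X assume "X \<in> prod_algebra I (\<lambda>_. N)"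
  then obtain J E where X: "X = prod_emb I (\<lambda>_. N) J (Pi\<^sub>E J E)" and J: "finite J" "J \<subseteq> I"
    and E: "\<And>i. i \<in> J \<Longrightarrow> E i \<in> sets N"
    by (auto elim!: prod_algebraE)
  \<comment> \<open>Cylinders form an intersection-stable generator, so measurability needs checking
    only on them; there the product measure is a finite product of values of the kernel.\<close>
  have eq: "emeasure (\<Pi>\<^sub>M i\<in>I. \<kappa> x) X = (\<Prod>i\<in>J. emeasure (\<kappa> x) (E i))" if x: "x \<in> space M" for x
  proof -
    have "X = prod_emb I (\<lambda>_. \<kappa> x) J (Pi\<^sub>E J E)"
      using sets_eq_imp_space_eq[OF s[OF x]] by (simp add: X prod_emb_def)
    then show ?thesis using J E by (simp add: emeasure_PiM_emb p s x)
  qed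
  have [measurable]: "\<kappa> \<in> M \<rightarrow>\<^sub>M subprob_algebra N" using L by (rule measurable_prob_algebraD)
  show "(\<lambda>x. emeasure (\<Pi>\<^sub>M i\<in>I. \<kappa> x) X) \<in> borel_measurable M"
    by (rule measurable_cong[THEN iffD2, OF eq]) (auto intro!: borel_measurable_prod_ennreal measurable_emeasure_kernel E)
qed

text \<open>The law of total variance for a prefix together with its siblings. Given
  \<open>h\<close> the siblings are i.i.d., so the conditional mean of the advantage is 0 and only
  the expected conditional variance remains. The assumption \<open>g2\<close> speaks of one
  continuation; square integrability of the advantage has to be derived from it first.\<close>

lemma branched_leave_one_out_variance:
  fixes g :: "'b \<Rightarrow> 'c \<Rightarrow> real"
  assumes P: "prob_space P" and \<kappa>: "\<kappa> \<in> P \<rightarrow>\<^sub>M prob_algebra N"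
    and g[measurable]: "(\<lambda>(h, y). g h y) \<in> borel_measurable (P \<Otimes>\<^sub>M N)"
    and g2: "integrable (P \<bind> (\<lambda>h. distr (\<kappa> h) (P \<Otimes>\<^sub>M N) (Pair h))) (\<lambda>(h, y). (g h y)\<^sup>2)"
    and K: "K \<ge> 2" and k: "k \<in> {1..K}"
  shows "prob_space.variance
      (P \<bind> (\<lambda>h. distr (\<Pi>\<^sub>M j\<in>{1..K}. \<kappa> h) (P \<Otimes>\<^sub>M (\<Pi>\<^sub>M j\<in>{1..K}. N)) (Pair h)))
      (\<lambda>(h, x). leave_one_out K (\<lambda>j. g h (x j)) k) =
    real K / (real K - 1) * (\<integral>h. prob_space.variance (\<kappa> h) (g h) \<partial>P)"
proof -
  interpret prob_space P by fact
  let ?PN = "P \<Otimes>\<^sub>M N" and ?X = "\<Pi>\<^sub>M j\<in>{1..K}. N"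
  let ?PX = "P \<Otimes>\<^sub>M ?X"
  define \<kappa>1 where "\<kappa>1 h = distr (\<kappa> h) ?PN (Pair h)" for h
  define \<kappa>2 where "\<kappa>2 h = distr (\<Pi>\<^sub>M j\<in>{1..K}. \<kappa> h) ?PX (Pair h)" for h
  define A where "A = (\<lambda>(h, x). leave_one_out K (\<lambda>j. g h (x j)) k)"
  define v where "v h = prob_space.variance (\<kappa> h) (g h)" for h
  define c where "c = real K / (real K - 1)"
  have \<kappa>1: "\<kappa>1 \<in> P \<rightarrow>\<^sub>M prob_algebra ?PN"
    unfolding \<kappa>1_def by (rule measurable_distr_prob_space2[OF \<kappa>]) simp
  have \<kappa>2: "\<kappa>2 \<in> P \<rightarrow>\<^sub>M prob_algebra ?PX"
    unfolding \<kappa>2_def by (rule measurable_distr_prob_space2[OF measurable_PiM_prob_algebra[OF \<kappa>]]) simp_all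
  have gj[measurable]: "(\<lambda>p. g (fst p) (snd p j)) \<in> borel_measurable ?PX" if "j \<in> {1..K}" for j
    using measurable_compose[OF measurable_Pair[OF measurable_fst
        measurable_compose[OF measurable_snd measurable_component_singleton[OF that]]] g] by simp
  have Am[measurable]: "A \<in> borel_measurable ?PX"
    unfolding A_def leave_one_out_def split_beta'
    by (intro borel_measurable_diff borel_measurable_times borel_measurable_const borel_measurable_sum gj k) auto
  have \<kappa>h: "prob_space (\<kappa> h)" "sets (\<kappa> h) = sets N" if "h \<in> space P" for h
    using measurable_space[OF \<kappa> that] by (auto simp: space_prob_algebra)
  have gh[measurable]: "g h \<in> borel_measurable N" if "h \<in> space P" for h
    using measurable_Pair2[OF g that] by simp
  have gh': "g h \<in> borel_measurable (\<kappa> h)" if "h \<in> space P" for h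
    using gh[OF that] by (simp only: measurable_cong_sets[OF \<kappa>h(2)[OF that] refl])
  have X: "sets (\<Pi>\<^sub>M j\<in>{1..K}. \<kappa> h) = sets ?X" if "h \<in> space P" for h
    by (rule sets_PiM_cong[OF refl \<kappa>h(2)[OF that]])
  have pair1: "Pair h \<in> \<kappa> h \<rightarrow>\<^sub>M ?PN" if "h \<in> space P" for h
    unfolding measurable_cong_sets[OF \<kappa>h(2)[OF that] refl] by (rule measurable_Pair1'[OF that])
  have pair2: "Pair h \<in> (\<Pi>\<^sub>M j\<in>{1..K}. \<kappa> h) \<rightarrow>\<^sub>M ?PX" if "h \<in> space P" for h
    unfolding measurable_cong_sets[OF X[OF that] refl] by (rule measurable_Pair1'[OF that])
  have g2': "integrable (P \<bind> \<kappa>1) (\<lambda>p. (case_prod g p)\<^sup>2)"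
    using g2 by (simp add: \<kappa>1_def[abs_def] split_beta')
  \<comment> \<open>Applied to a single continuation, this supplies a finite second moment for
    almost every \<open>h\<close> and the integrability of \<open>v\<close>.\<close>
  note tv1 = law_of_total_variance[OF P \<kappa>1 g g2']
  have AE1: "AE h in P. integrable (\<kappa> h) (\<lambda>y. (g h y)\<^sup>2)"
    using tv1(1) AE_space
  proof eventually_elim
    case (elim h)
    then show ?case
      by (simp add: \<kappa>1_def integrable_distr_eq[OF pair1[OF elim(2)]])
  qed
  have "prob_space.variance (\<kappa>1 h) (case_prod g) = v h" if "h \<in> space P" for h
    unfolding v_def \<kappa>1_def by (simp add: integral_distr[OF pair1[OF that]])
  then have vi: "integrable P v"
    using tv1(4) by (simp cong: Bochner_Integration.integrable_cong)
  note loo = leave_one_out_moments[OF \<kappa>h(1) gh' _ K k]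
  \<comment> \<open>The extended integral of the squared advantage serves to prove square
    integrability under the mixture; the Bochner integral is the conditional variance, because the
    conditional mean is 0.\<close>
  have moments: "AE h in P. integral\<^sup>L (\<kappa>2 h) A = 0 \<and> (\<integral>\<^sup>+p. ennreal ((A p)\<^sup>2) \<partial>\<kappa>2 h) = ennreal (c * v h) \<and>
      (\<integral>p. (A p)\<^sup>2 \<partial>\<kappa>2 h) = c * v h"
    using AE1 AE_space
  proof eventually_elim
    case (elim h)
    note l = loo[OF elim(2) elim(2) elim(1)]
    have "(\<integral>\<^sup>+p. ennreal ((A p)\<^sup>2) \<partial>\<kappa>2 h) =
        (\<integral>\<^sup>+x. ennreal ((A (h, x))\<^sup>2) \<partial>(\<Pi>\<^sub>M j\<in>{1..K}. \<kappa> h))"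
      unfolding \<kappa>2_def by (rule nn_integral_distr[OF pair2[OF elim(2)]]) measurable
    also have "\<dots> = (\<integral>\<^sup>+x. ennreal ((leave_one_out K (\<lambda>j. g h (x j)) k)\<^sup>2) \<partial>(\<Pi>\<^sub>M j\<in>{1..K}. \<kappa> h))"
      by (simp add: A_def)
    also have "\<dots> = ennreal (c * v h)"
      using nn_integral_eq_integral[OF l(2)] l(3) by (simp add: c_def v_def)
    finally have "(\<integral>\<^sup>+p. ennreal ((A p)\<^sup>2) \<partial>\<kappa>2 h) = ennreal (c * v h)" .
    moreover have "integral\<^sup>L (\<kappa>2 h) A = (\<integral>x. A (h, x) \<partial>(\<Pi>\<^sub>M j\<in>{1..K}. \<kappa> h))"
      unfolding \<kappa>2_def by (rule integral_distr[OF pair2[OF elim(2)]]) measurable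
    moreover have "(\<integral>p. (A p)\<^sup>2 \<partial>\<kappa>2 h) = (\<integral>x. (A (h, x))\<^sup>2 \<partial>(\<Pi>\<^sub>M j\<in>{1..K}. \<kappa> h))"
      unfolding \<kappa>2_def by (rule integral_distr[OF pair2[OF elim(2)]]) measurable
    ultimately show ?case
      using l(1,3) by (simp add: A_def c_def v_def)
  qed
  have sets2: "sets (P \<bind> \<kappa>2) = sets ?PX"
    by (rule sets_bind_measurable[OF measurable_prob_algebraD[OF \<kappa>2] not_empty])
  have AB: "A \<in> borel_measurable (P \<bind> \<kappa>2)"
    using Am by (simp only: measurable_cong_sets[OF sets2 refl])
  have "(\<integral>\<^sup>+p. ennreal ((A p)\<^sup>2) \<partial>(P \<bind> \<kappa>2)) = (\<integral>\<^sup>+h. \<integral>\<^sup>+p. ennreal ((A p)\<^sup>2) \<partial>\<kappa>2 h \<partial>P)"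
    by (rule nn_integral_bind[OF _ measurable_prob_algebraD[OF \<kappa>2]]) measurable
  also have "\<dots> = (\<integral>\<^sup>+h. ennreal (c * v h) \<partial>P)"
    using moments by (intro nn_integral_cong_AE) auto
  also have "\<dots> < \<infinity>"
    using integrableD(2)[of P "\<lambda>h. c * v h"] vi by (simp add: less_top)
  finally have A2: "integrable (P \<bind> \<kappa>2) (\<lambda>p. (A p)\<^sup>2)"
    using AB by (intro integrableI_nonneg) auto
  note tv2 = law_of_total_variance[OF P \<kappa>2 Am A2]
  have E0: "AE h in P. integral\<^sup>L (\<kappa>2 h) A = 0" using moments by auto
  have "expectation (\<lambda>h. integral\<^sup>L (\<kappa>2 h) A) = 0"
    using integral_cong_AE[OF _ _ E0] tv2(2) by auto
  then have V0: "variance (\<lambda>h. integral\<^sup>L (\<kappa>2 h) A) = 0"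
    using E0 by (simp add: integral_eq_zero_AE)
  have "AE h in P. prob_space.variance (\<kappa>2 h) A = c * v h"
    using moments by eventually_elim auto
  then have "(\<integral>h. prob_space.variance (\<kappa>2 h) A \<partial>P) = (\<integral>h. c * v h \<partial>P)"
    using tv2(4) vi by (intro integral_cong_AE) auto
  then have "prob_space.variance (P \<bind> \<kappa>2) A = c * (\<integral>h. v h \<partial>P)"
    using tv2(5) V0 by simp
  then show ?thesis
    by (simp add: \<kappa>2_def[abs_def] A_def c_def v_def)
qed

subsection \<open>The Markov property of rollouts\<close>

text \<open>Every finite index set lies in an initial segment, so the marginals on such segments
  determine all cylinder probabilities. The offset \<open>m\<close> allows comparing only segments
  that contain a whole prefix of length \<open>m\<close>.\<close>

lemma measure_eqI_PiM_restrict: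
  fixes P Q :: "(nat \<Rightarrow> 'a) measure"
  assumes "prob_space P" and P: "sets P = sets (\<Pi>\<^sub>M i\<in>UNIV. N)" and Q: "sets Q = sets (\<Pi>\<^sub>M i\<in>UNIV. N)"
    and eq: "\<And>n. distr P (\<Pi>\<^sub>M i\<in>{0..<m + n}. N) (\<lambda>\<omega>. restrict \<omega> {0..<m + n}) =
                  distr Q (\<Pi>\<^sub>M i\<in>{0..<m + n}. N) (\<lambda>\<omega>. restrict \<omega> {0..<m + n})"
  shows "P = Q"
proof (rule measure_eqI_PiM_infinite[OF P Q])
  interpret prob_space P by fact
  show "finite_measure P" by (rule finite_measure_axioms)
  fix A :: "nat \<Rightarrow> 'a set" and J :: "nat set"
  assume J: "finite J" "J \<subseteq> UNIV" and A: "\<And>i. i \<in> J \<Longrightarrow> A i \<in> sets N"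
  obtain n where n: "J \<subseteq> {0..<n}"
    using finite_nat_iff_bounded[of J] J by (auto simp: lessThan_atLeast0)
  let ?I = "{0..<m + n}"
  have n': "J \<subseteq> ?I" using n by fastforce
  let ?X = "prod_emb ?I (\<lambda>_. N) J (Pi\<^sub>E J A)"
  have X: "?X \<in> sets (\<Pi>\<^sub>M i\<in>?I. N)"
    using A J n' by (intro sets_PiM_I) auto
  have e: "prod_emb UNIV (\<lambda>_. N) J (Pi\<^sub>E J A) = (\<lambda>\<omega>. restrict \<omega> ?I) -` ?X \<inter> space (\<Pi>\<^sub>M i\<in>UNIV. N)"
    using n' by (auto simp: prod_emb_def space_PiM Int_absorb1 PiE_iff)
  have E: "emeasure R (prod_emb UNIV (\<lambda>_. N) J (Pi\<^sub>E J A)) =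
      emeasure (distr R (\<Pi>\<^sub>M i\<in>?I. N) (\<lambda>\<omega>. restrict \<omega> ?I)) ?X"
    if "sets R = sets (\<Pi>\<^sub>M i\<in>UNIV. N)" for R :: "(nat \<Rightarrow> 'a) measure"
    using that X sets_eq_imp_space_eq[OF that]
    by (subst emeasure_distr) (auto simp: e measurable_cong_sets[OF that refl] intro!: measurable_restrict)
  show "emeasure P (prod_emb UNIV (\<lambda>_. N) J (Pi\<^sub>E J A)) = emeasure Q (prod_emb UNIV (\<lambda>_. N) J (Pi\<^sub>E J A))"
    unfolding E[OF P] E[OF Q] eq ..
qed

lemma measurable_comb_seq_prefix:
  "(\<lambda>(h, \<omega>). comb_seq t h \<omega>) \<in>
     (\<Pi>\<^sub>M i\<in>{0..<t}. N) \<Otimes>\<^sub>M (\<Pi>\<^sub>M i\<in>UNIV. N) \<rightarrow>\<^sub>M (\<Pi>\<^sub>M i\<in>UNIV. N)"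
proof (rule measurable_PiM_single')
  show "(\<lambda>\<omega>. (\<lambda>(h, \<omega>). comb_seq t h \<omega>) \<omega> j) \<in> (\<Pi>\<^sub>M i\<in>{0..<t}. N) \<Otimes>\<^sub>M (\<Pi>\<^sub>M i\<in>UNIV. N) \<rightarrow>\<^sub>M N" for j
    by (cases "j < t") (auto simp: comb_seq_def split_beta')
qed (auto simp: space_pair_measure space_PiM PiE_iff split: split_comb_seq)

lemma measurable_comb_seq_finite:
  "(\<lambda>(h, \<omega>). comb_seq t h \<omega>) \<in>
     (\<Pi>\<^sub>M i\<in>{0..<t}. N) \<Otimes>\<^sub>M (\<Pi>\<^sub>M i\<in>{0..<n}. N) \<rightarrow>\<^sub>M (\<Pi>\<^sub>M i\<in>{0..<t + n}. N)"
proof (rule measurable_PiM_single')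
  show "(\<lambda>\<omega>. (\<lambda>(h, \<omega>). comb_seq t h \<omega>) \<omega> j) \<in>
      (\<Pi>\<^sub>M i\<in>{0..<t}. N) \<Otimes>\<^sub>M (\<Pi>\<^sub>M i\<in>{0..<n}. N) \<rightarrow>\<^sub>M N" if "j \<in> {0..<t + n}" for j
    using that by (cases "j < t") (auto simp: comb_seq_def split_beta')
\<comment> \<open>From \<open>t + n\<close> on, the glued sequence reads \<open>\<omega>\<close> at
  indices \<open>\<ge> n\<close>, where it is \<open>undefined\<close>; hence the result is
  extensional again.\<close>
qed (auto simp: space_pair_measure space_PiM PiE_iff extensional_def comb_seq_def)

lemma measurable_state_at_pair:
  "(\<lambda>(s, \<omega>). state_at s \<omega> n) \<in> states M \<Otimes>\<^sub>M (\<Pi>\<^sub>M i\<in>I. step_space M) \<rightarrow>\<^sub>M states M"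
  if "n = 0 \<or> n - 1 \<in> I"
  using that by (cases n) (auto simp: state_at_def step_space_def split_beta')

lemma measurable_state_at:
  "(\<lambda>\<omega>. state_at s \<omega> n) \<in> (\<Pi>\<^sub>M i\<in>I. step_space M) \<rightarrow>\<^sub>M states M"
  if "s \<in> space (states M)" "n = 0 \<or> n - 1 \<in> I"
  using measurable_Pair2[OF measurable_state_at_pair[OF that(2)] that(1)] by simp

text \<open>The pathwise core of the Markov property. At \<open>n = 0\<close> both sides are the
  last state of the prefix, or \<open>s\<close> itself when \<open>t = 0\<close>.\<close>

lemma state_at_comb_seq: "state_at s (comb_seq t h \<omega>) (t + n) = state_at (state_at s h t) \<omega> n"
  by (cases n; cases t) (auto simp: state_at_def comb_seq_def)

section \<open>Step kernels and the laws of initial segments\<close>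

locale mdp_policy =
  fixes M :: "('s, 'a) mdp" and \<pi> :: "'s \<Rightarrow> 'a measure"
  assumes mdp: "is_mdp M" and policy: "is_policy M \<pi>"
begin

abbreviation "T \<equiv> \<Pi>\<^sub>M i\<in>(UNIV :: nat set). step_space M"

lemma measurable_step_law: "step_law M \<pi> \<in> states M \<rightarrow>\<^sub>M prob_algebra (step_space M)"
proof -
  have [measurable]: "kernel M \<in> states M \<Otimes>\<^sub>M actions M \<rightarrow>\<^sub>M prob_algebra (borel \<Otimes>\<^sub>M states M)"
    "\<pi> \<in> states M \<rightarrow>\<^sub>M prob_algebra (actions M)"
    using mdp policy by (auto simp: is_mdp_def is_policy_def)
  show ?thesis
    unfolding step_law_def[abs_def] step_space_def by measurable
qed

lemma Ionescu_Tulcea_step_law: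
  assumes s: "s \<in> space (states M)"
  shows "Ionescu_Tulcea (\<lambda>i \<omega>. step_law M \<pi> (state_at s \<omega> i)) (\<lambda>_. step_space M)"
proof (rule Ionescu_Tulcea.intro)
  fix i
  have *: "(\<lambda>\<omega>. step_law M \<pi> (state_at s \<omega> i)) \<in> (\<Pi>\<^sub>M j\<in>{0..<i}. step_space M) \<rightarrow>\<^sub>M prob_algebra (step_space M)"
    by (rule measurable_compose[OF measurable_state_at[OF s] measurable_step_law]) auto
  show "(\<lambda>\<omega>. step_law M \<pi> (state_at s \<omega> i)) \<in> (\<Pi>\<^sub>M j\<in>{0..<i}. step_space M) \<rightarrow>\<^sub>M subprob_algebra (step_space M)"
    using * by (rule measurable_prob_algebraD)
  fix x assume "x \<in> space (\<Pi>\<^sub>M j\<in>{0..<i}. step_space M)"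
  then show "prob_space (step_law M \<pi> (state_at s x i))"
    using measurable_space[OF *] by (auto simp: space_prob_algebra)
qed

text \<open>This is the kernel \<open>eP\<close> of the Ionescu-Tulcea construction, with the
  initial state as an argument so that measurability can be stated jointly in \<open>s\<close> and
  \<open>\<omega>\<close>.\<close>

definition next_law :: "'s \<Rightarrow> nat \<Rightarrow> ('s, 'a) trajectory \<Rightarrow> ('s, 'a) trajectory measure" where
  "next_law s n \<omega> =
     distr (step_law M \<pi> (state_at s \<omega> n)) (\<Pi>\<^sub>M i\<in>{0..<Suc n}. step_space M) (fun_upd \<omega> n)"

lemma measurable_next_law_pair:
  "(\<lambda>(s, \<omega>). next_law s n \<omega>) \<in>
     states M \<Otimes>\<^sub>M (\<Pi>\<^sub>M i\<in>{0..<n}. step_space M) \<rightarrow>\<^sub>M prob_algebra (\<Pi>\<^sub>M i\<in>{0..<Suc n}. step_space M)"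
proof -
  have 1: "(\<lambda>p. step_law M \<pi> (state_at (fst p) (snd p) n)) \<in>
      states M \<Otimes>\<^sub>M (\<Pi>\<^sub>M i\<in>{0..<n}. step_space M) \<rightarrow>\<^sub>M prob_algebra (step_space M)"
    using measurable_compose[OF measurable_state_at_pair measurable_step_law, of n "{0..<n}"]
    by (cases n) (auto simp: split_beta')
  have 2: "(\<lambda>p. (snd (fst p))(n := snd p)) \<in>
      (states M \<Otimes>\<^sub>M (\<Pi>\<^sub>M i\<in>{0..<n}. step_space M)) \<Otimes>\<^sub>M step_space M \<rightarrow>\<^sub>M (\<Pi>\<^sub>M i\<in>{0..<Suc n}. step_space M)"
    by (rule measurable_fun_upd[where J="{0..<n}"]) auto
  show ?thesis
    unfolding next_law_def split_beta'
    by (rule measurable_distr_prob_space2[OF 1]) (use 2 in \<open>simp add: split_beta'\<close>)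
qed

lemma measurable_next_law:
  "s \<in> space (states M) \<Longrightarrow> next_law s n \<in>
     (\<Pi>\<^sub>M i\<in>{0..<n}. step_space M) \<rightarrow>\<^sub>M prob_algebra (\<Pi>\<^sub>M i\<in>{0..<Suc n}. step_space M)"
  using measurable_Pair2[OF measurable_next_law_pair] by simp

text \<open>These are the iterates \<open>C 0 n\<close> of the Ionescu-Tulcea construction as
  functions of the initial state. The recursion starts at \<open>\<lambda>_. undefined\<close>, the
  only point of the product over no coordinates.\<close>

primrec steps_law :: "nat \<Rightarrow> 's \<Rightarrow> ('s, 'a) trajectory measure" where
  "steps_law 0 s = return (\<Pi>\<^sub>M i\<in>{0..<0}. step_space M) (\<lambda>_. undefined)"
| "steps_law (Suc n) s = steps_law n s \<bind> next_law s n"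

lemma measurable_steps_law:
  "steps_law n \<in> states M \<rightarrow>\<^sub>M prob_algebra (\<Pi>\<^sub>M i\<in>{0..<n}. step_space M)"
proof (induction n)
  case 0
  show ?case
    by (auto intro!: measurable_const simp: space_prob_algebra space_PiM intro!: prob_space_return)
next
  case (Suc n)
  show ?case
    using measurable_bind_prob_space2[OF Suc measurable_next_law_pair] by simp
qed

lemma prob_space_steps_law: "s \<in> space (states M) \<Longrightarrow> prob_space (steps_law n s)"
  and sets_steps_law: "s \<in> space (states M) \<Longrightarrow> sets (steps_law n s) = sets (\<Pi>\<^sub>M i\<in>{0..<n}. step_space M)"
  using measurable_space[OF measurable_steps_law, of s n] by (auto simp: space_prob_algebra)

lemma space_steps_law: "s \<in> space (states M) \<Longrightarrow> space (steps_law n s) = space (\<Pi>\<^sub>M i\<in>{0..<n}. step_space M)"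
  by (rule sets_eq_imp_space_eq[OF sets_steps_law])

lemma sets_rollout: "s \<in> space (states M) \<Longrightarrow> sets (rollout M \<pi> s) = sets T"
proof -
  assume s: "s \<in> space (states M)"
  interpret Ionescu_Tulcea "\<lambda>i \<omega>. step_law M \<pi> (state_at s \<omega> i)" "\<lambda>_. step_space M"
    by (rule Ionescu_Tulcea_step_law[OF s])
  show ?thesis unfolding rollout_def by (rule PF.sets_lim)
qed

lemma space_rollout: "s \<in> space (states M) \<Longrightarrow> space (rollout M \<pi> s) = space T"
  by (rule sets_eq_imp_space_eq[OF sets_rollout])

text \<open>The projective limit has the prescribed marginals \<open>CI\<close>, and on an initial
  segment of length \<open>n\<close> these come from iterating the step kernels \<open>n\<close>
  times.\<close>

lemma distr_rollout_restrict:
  assumes s: "s \<in> space (states M)"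
  shows "distr (rollout M \<pi> s) (\<Pi>\<^sub>M i\<in>{0..<n}. step_space M) (\<lambda>\<omega>. restrict \<omega> {0..<n}) = steps_law n s"
proof -
  interpret Ionescu_Tulcea "\<lambda>i \<omega>. step_law M \<pi> (state_at s \<omega> i)" "\<lambda>_. step_space M"
    by (rule Ionescu_Tulcea_step_law[OF s])
  have eP: "eP m = next_law s m" for m
    by (simp add: eP_def next_law_def fun_eq_iff)
  have C: "C 0 m (\<lambda>_. undefined) = steps_law m s" for m
    by (induction m) (simp_all add: eP)
  \<comment> \<open>\<open>up_to\<close> is the least bound above an index set. For a segment this
    is its length, so the restriction inside \<open>CI\<close> drops no coordinate and is the
    identity.\<close>
  have u: "up_to {0..<n} = n"
    using up_to[of "{0..<n}"] by (intro antisym) (auto simp: up_to_iff)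
  have "distr (rollout M \<pi> s) (\<Pi>\<^sub>M i\<in>{0..<n}. step_space M) (\<lambda>\<omega>. restrict \<omega> {0..<n}) = CI {0..<n}"
    unfolding rollout_def by (rule distr_lim) simp
  also have "\<dots> = distr (steps_law n s) (\<Pi>\<^sub>M i\<in>{0..<n}. step_space M) (\<lambda>\<omega>. restrict \<omega> {0..<n})"
    by (simp add: CI_def u C)
  also have "\<dots> = distr (steps_law n s) (steps_law n s) (\<lambda>\<omega>. \<omega>)"
    using space_steps_law[OF s]
    by (intro distr_cong) (auto simp: sets_steps_law[OF s] space_PiM)
  finally show ?thesis by (simp add: distr_id)
qed

text \<open>Push-forward preserves total mass, and the marginal on no coordinates is the point mass
  \<open>steps_law 0 s\<close>.\<close>

lemma prob_space_rollout:
  assumes s: "s \<in> space (states M)"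
  shows "prob_space (rollout M \<pi> s)"
proof (rule prob_space_distrD)
  show "(\<lambda>\<omega>. restrict \<omega> {0..<0}) \<in> rollout M \<pi> s \<rightarrow>\<^sub>M (\<Pi>\<^sub>M i\<in>{0..<0}. step_space M)"
    unfolding measurable_cong_sets[OF sets_rollout[OF s] refl] by (rule measurable_restrict) simp
  show "prob_space (distr (rollout M \<pi> s) (\<Pi>\<^sub>M i\<in>{0..<0}. step_space M) (\<lambda>\<omega>. restrict \<omega> {0..<0}))"
    unfolding distr_rollout_restrict[OF s] by (rule prob_space_steps_law[OF s])
qed

text \<open>A cylinder involves finitely many steps, so its probability can be computed under
  \<open>steps_law n s\<close> with the same \<open>n\<close> for every \<open>s\<close>, and
  \<open>steps_law n\<close> is already a measurable kernel.\<close>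

lemma measurable_rollout: "rollout M \<pi> \<in> states M \<rightarrow>\<^sub>M prob_algebra T"
proof (rule measurable_prob_algebra_generated[OF sets_PiM Int_stable_prod_algebra prod_algebra_sets_into_space])
  fix X assume "X \<in> prod_algebra UNIV (\<lambda>_::nat. step_space M)"
  then obtain J E where X: "X = prod_emb UNIV (\<lambda>_. step_space M) J (Pi\<^sub>E J E)" and J: "finite J"
    and E: "\<And>i. i \<in> J \<Longrightarrow> E i \<in> sets (step_space M)"
    by (auto elim!: prod_algebraE)
  obtain n where n: "J \<subseteq> {0..<n}"
    using finite_nat_iff_bounded[of J] J by (auto simp: lessThan_atLeast0)
  let ?Y = "prod_emb {0..<n} (\<lambda>_. step_space M) J (Pi\<^sub>E J E)"
  have Y[measurable]: "?Y \<in> sets (\<Pi>\<^sub>M i\<in>{0..<n}. step_space M)"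
    using E J n by (intro sets_PiM_I) auto
  have eq: "emeasure (rollout M \<pi> s) X = emeasure (steps_law n s) ?Y" if s: "s \<in> space (states M)" for s
    unfolding distr_rollout_restrict[OF s, symmetric] using Y n
    by (subst emeasure_distr)
       (auto simp: measurable_cong_sets[OF sets_rollout[OF s] refl] space_rollout[OF s] X prod_emb_def
          space_PiM Int_absorb1 PiE_iff intro!: measurable_restrict arg_cong[where f="emeasure _"])
  have [measurable]: "steps_law n \<in> states M \<rightarrow>\<^sub>M subprob_algebra (\<Pi>\<^sub>M i\<in>{0..<n}. step_space M)"
    by (rule measurable_prob_algebraD[OF measurable_steps_law])
  show "(\<lambda>s. emeasure (rollout M \<pi> s) X) \<in> borel_measurable (states M)"
    by (rule measurable_cong[THEN iffD2, OF eq]) measurable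
qed (auto simp: prob_space_rollout sets_rollout)

section \<open>Chapman-Kolmogorov and the Markov property\<close>

lemma next_law_comb_seq:
  assumes s: "s \<in> space (states M)" and h: "h \<in> space (\<Pi>\<^sub>M i\<in>{0..<t}. step_space M)"
    and w: "\<omega> \<in> space (\<Pi>\<^sub>M i\<in>{0..<n}. step_space M)"
  shows "next_law s (t + n) (comb_seq t h \<omega>) =
    distr (next_law (state_at s h t) n \<omega>) (\<Pi>\<^sub>M i\<in>{0..<t + Suc n}. step_space M) (comb_seq t h)"
proof -
  have st: "state_at s h t \<in> space (states M)"
    using measurable_space[OF measurable_state_at[OF s, of t "{0..<t}"] h] by (cases t) auto
  let ?L = "step_law M \<pi> (state_at (state_at s h t) \<omega> n)"
  have "state_at (state_at s h t) \<omega> n \<in> space (states M)"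
    using measurable_space[OF measurable_state_at[OF st, of n "{0..<n}"] w] by (cases n) auto
  then have L: "sets ?L = sets (step_space M)"
    using measurable_space[OF measurable_step_law] by (auto simp: space_prob_algebra)
  \<comment> \<open>Gluing shifts the continuation by \<open>t\<close>, so writing position
    \<open>t + n\<close> after gluing is the same as writing position \<open>n\<close> before it.
    The step law agrees on both sides by \<open>state_at_comb_seq\<close>.\<close>
  have u: "fun_upd (comb_seq t h \<omega>) (t + n) = (\<lambda>x. comb_seq t h (fun_upd \<omega> n x))"
    by (auto simp: fun_eq_iff comb_seq_def)
  have 1: "fun_upd \<omega> n \<in> ?L \<rightarrow>\<^sub>M (\<Pi>\<^sub>M i\<in>{0..<Suc n}. step_space M)"
    using w by (intro measurable_fun_upd[where J="{0..<n}"]) (auto simp: measurable_cong_sets[OF L refl])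
  have 2: "comb_seq t h \<in> (\<Pi>\<^sub>M i\<in>{0..<Suc n}. step_space M) \<rightarrow>\<^sub>M (\<Pi>\<^sub>M i\<in>{0..<t + Suc n}. step_space M)"
    using measurable_Pair2[OF measurable_comb_seq_finite[of t _ "Suc n"] h] by simp
  show ?thesis
    unfolding next_law_def state_at_comb_seq
    by (subst distr_distr[OF 2 1]) (simp add: comp_def u)
qed

text \<open>Induction on \<open>n\<close>: associativity of bind moves the last step under the
  integral over the prefix, where \<open>next_law_comb_seq\<close> hands it to the
  continuation.\<close>

lemma steps_law_add:
  assumes s: "s \<in> space (states M)"
  shows "steps_law (t + n) s = steps_law t s \<bind>
    (\<lambda>h. distr (steps_law n (state_at s h t)) (\<Pi>\<^sub>M i\<in>{0..<t + n}. step_space M) (comb_seq t h))"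
proof (induction n)
  case 0
  interpret prob_space "steps_law t s" by (rule prob_space_steps_law[OF s])
  have "steps_law t s \<bind> (\<lambda>h. distr (steps_law 0 (state_at s h t)) (\<Pi>\<^sub>M i\<in>{0..<t + 0}. step_space M) (comb_seq t h))
      = steps_law t s \<bind> return (\<Pi>\<^sub>M i\<in>{0..<t}. step_space M)"
  proof (rule bind_cong[OF refl])
    fix h assume "h \<in> space (steps_law t s)"
    then have h: "h \<in> space (\<Pi>\<^sub>M i\<in>{0..<t}. step_space M)" by (simp add: space_steps_law[OF s])
    \<comment> \<open>With an empty continuation gluing gives back the prefix, because
      \<open>h\<close> is \<open>undefined\<close> from \<open>t\<close> on.\<close>
    have c: "comb_seq t h (\<lambda>_. undefined) = h"
      using h by (auto simp: comb_seq_def fun_eq_iff space_PiM PiE_iff extensional_def)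
    show "distr (steps_law 0 (state_at s h t)) (\<Pi>\<^sub>M i\<in>{0..<t + 0}. step_space M) (comb_seq t h) = return (\<Pi>\<^sub>M i\<in>{0..<t}. step_space M) h"
      using measurable_Pair2[OF measurable_comb_seq_finite[of t _ 0] h]
      by (simp add: distr_return space_PiM c)
  qed
  also have "\<dots> = steps_law t s"
    by (rule bind_return'') (rule sets_steps_law[OF s])
  finally show ?case by simp
next
  case (Suc n)
  let ?P = "\<lambda>k. \<Pi>\<^sub>M i\<in>{0..<k}. step_space M"
  have st: "state_at s h t \<in> space (states M)" if "h \<in> space (?P t)" for h
    using measurable_space[OF measurable_state_at[OF s, of t "{0..<t}"] that] by (cases t) auto
  have stm: "(\<lambda>h. state_at s h t) \<in> ?P t \<rightarrow>\<^sub>M states M"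
    by (rule measurable_state_at[OF s]) auto
  have D: "(\<lambda>h. distr (steps_law n (state_at s h t)) (?P (t + n)) (comb_seq t h)) \<in> ?P t \<rightarrow>\<^sub>M subprob_algebra (?P (t + n))"
    by (rule measurable_distr2[OF measurable_comb_seq_finite])
       (rule measurable_compose[OF stm measurable_prob_algebraD[OF measurable_steps_law]])
  have N: "next_law s' k \<in> ?P k \<rightarrow>\<^sub>M subprob_algebra (?P (Suc k))" if "s' \<in> space (states M)" for s' k
    using measurable_prob_algebraD[OF measurable_next_law[OF that]] .
  have "steps_law (t + Suc n) s = steps_law t s \<bind>
      (\<lambda>h. distr (steps_law n (state_at s h t)) (?P (t + n)) (comb_seq t h)) \<bind> next_law s (t + n)"
    by (simp add: Suc)
  also have "\<dots> = steps_law t s \<bind>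
      (\<lambda>h. distr (steps_law n (state_at s h t)) (?P (t + n)) (comb_seq t h) \<bind> next_law s (t + n))"
    by (rule bind_assoc[OF _ N[OF s]]) (use D in \<open>simp add: measurable_cong_sets[OF sets_steps_law[OF s] refl]\<close>)
  also have "\<dots> = steps_law t s \<bind>
      (\<lambda>h. distr (steps_law (Suc n) (state_at s h t)) (?P (t + Suc n)) (comb_seq t h))"
  proof (rule bind_cong[OF refl])
    fix h assume "h \<in> space (steps_law t s)"
    then have h: "h \<in> space (?P t)" by (simp add: space_steps_law[OF s])
    have m: "comb_seq t h \<in> ?P k \<rightarrow>\<^sub>M ?P (t + k)" for k
      using measurable_Pair2[OF measurable_comb_seq_finite h] by simp
    note S = sets_steps_law[OF st[OF h], of n]
    have ne: "space (steps_law n (state_at s h t)) \<noteq> {}"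
      by (rule prob_space.not_empty[OF prob_space_steps_law[OF st[OF h]]])
    have "distr (steps_law n (state_at s h t)) (?P (t + n)) (comb_seq t h) \<bind> next_law s (t + n) =
        steps_law n (state_at s h t) \<bind> (\<lambda>\<omega>. next_law s (t + n) (comb_seq t h \<omega>))"
      by (rule bind_distr[OF _ N[OF s] ne]) (use m in \<open>simp add: measurable_cong_sets[OF S refl]\<close>)
    also have "\<dots> = steps_law n (state_at s h t) \<bind>
        (\<lambda>\<omega>. distr (next_law (state_at s h t) n \<omega>) (?P (t + Suc n)) (comb_seq t h))"
      by (rule bind_cong[OF refl])
         (use next_law_comb_seq[OF s h] in \<open>simp add: space_steps_law[OF st[OF h]]\<close>)
    also have "\<dots> = distr (steps_law (Suc n) (state_at s h t)) (?P (t + Suc n)) (comb_seq t h)"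
      unfolding steps_law.simps
      by (rule distr_bind[symmetric, OF _ ne m])
         (use N[OF st[OF h]] in \<open>simp add: measurable_cong_sets[OF S refl]\<close>)
    finally show "distr (steps_law n (state_at s h t)) (?P (t + n)) (comb_seq t h) \<bind> next_law s (t + n) =
        distr (steps_law (Suc n) (state_at s h t)) (?P (t + Suc n)) (comb_seq t h)" .
  qed
  finally show ?case .
qed

lemma measurable_rollout_state_at:
  assumes s: "s \<in> space (states M)"
  shows "(\<lambda>h. rollout M \<pi> (state_at s h t)) \<in> (\<Pi>\<^sub>M i\<in>{0..<t}. step_space M) \<rightarrow>\<^sub>M prob_algebra T"
  by (rule measurable_compose[OF measurable_state_at[OF s] measurable_rollout]) auto

text \<open>Both measures have the same marginals on the segments \<open>{0..<t + n}\<close> by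
  \<open>steps_law_add\<close>, and these segments determine a measure on trajectories.\<close>

lemma rollout_Markov:
  assumes s: "s \<in> space (states M)"
  shows "rollout M \<pi> s =
    steps_law t s \<bind> (\<lambda>h. distr (rollout M \<pi> (state_at s h t)) T (comb_seq t h))"
proof (rule measure_eqI_PiM_restrict[where m=t and N="step_space M"])
  let ?P = "\<lambda>k. \<Pi>\<^sub>M i\<in>{0..<k}. step_space M"
  let ?K = "\<lambda>h. distr (rollout M \<pi> (state_at s h t)) T (comb_seq t h)"
  have K: "?K \<in> ?P t \<rightarrow>\<^sub>M subprob_algebra T"
    by (rule measurable_distr2[OF measurable_comb_seq_prefix])
       (rule measurable_prob_algebraD[OF measurable_rollout_state_at[OF s]])
  have K': "?K \<in> steps_law t s \<rightarrow>\<^sub>M subprob_algebra T"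
    using K by (simp add: measurable_cong_sets[OF sets_steps_law[OF s] refl])
  have ne: "space (steps_law t s) \<noteq> {}"
    by (rule prob_space.not_empty[OF prob_space_steps_law[OF s]])
  show "prob_space (rollout M \<pi> s)" by (rule prob_space_rollout[OF s])
  show "sets (rollout M \<pi> s) = sets T" by (rule sets_rollout[OF s])
  show "sets (steps_law t s \<bind> ?K) = sets T"
    by (rule sets_bind[OF _ ne]) simp
  fix n
  let ?r = "\<lambda>\<omega>. restrict \<omega> {0..<t + n}"
  have "distr (steps_law t s \<bind> ?K) (?P (t + n)) ?r = steps_law t s \<bind> (\<lambda>h. distr (?K h) (?P (t + n)) ?r)"
    by (rule distr_bind[OF K' ne]) (auto intro!: measurable_restrict)
  also have "\<dots> = steps_law t s \<bind>
    (\<lambda>h. distr (steps_law n (state_at s h t)) (?P (t + n)) (comb_seq t h))"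
  proof (rule bind_cong[OF refl])
    fix h assume "h \<in> space (steps_law t s)"
    then have h: "h \<in> space (?P t)" by (simp add: space_steps_law[OF s])
    have st: "state_at s h t \<in> space (states M)"
      using measurable_space[OF measurable_state_at[OF s, of t "{0..<t}"] h] by (cases t) auto
    note R = measurable_cong_sets[OF sets_rollout[OF st] refl]
    have m1: "comb_seq t h \<in> T \<rightarrow>\<^sub>M T" using measurable_Pair2[OF measurable_comb_seq_prefix h] by simp
    have m2: "comb_seq t h \<in> ?P n \<rightarrow>\<^sub>M ?P (t + n)" using measurable_Pair2[OF measurable_comb_seq_finite h] by simp
    \<comment> \<open>Cutting the glued trajectory at \<open>t + n\<close> cuts the continuation at
      \<open>n\<close>, so only the finite marginals of the fresh rollout enter.\<close>
    have e: "restrict (comb_seq t h \<omega>) {0..<t + n} = comb_seq t h (restrict \<omega> {0..<n})" for \<omega>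
      using h by (auto simp: fun_eq_iff comb_seq_def space_PiM PiE_iff extensional_def)
    have r: "(\<lambda>\<omega>. restrict \<omega> {0..<k}) \<in> T \<rightarrow>\<^sub>M ?P k" for k
      by (auto intro!: measurable_restrict)
    have "distr (?K h) (?P (t + n)) ?r = distr (rollout M \<pi> (state_at s h t)) (?P (t + n)) (?r \<circ> comb_seq t h)"
      by (rule distr_distr[OF r]) (use m1 in \<open>simp add: R\<close>)
    also have "?r \<circ> comb_seq t h = comb_seq t h \<circ> (\<lambda>\<omega>. restrict \<omega> {0..<n})"
      by (simp add: fun_eq_iff e)
    also have "distr (rollout M \<pi> (state_at s h t)) (?P (t + n)) (comb_seq t h \<circ> (\<lambda>\<omega>. restrict \<omega> {0..<n})) =
        distr (steps_law n (state_at s h t)) (?P (t + n)) (comb_seq t h)"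
      unfolding distr_rollout_restrict[OF st, symmetric]
      by (rule distr_distr[OF m2, symmetric]) (use r in \<open>simp add: R\<close>)
    finally show "distr (?K h) (?P (t + n)) ?r = distr (steps_law n (state_at s h t)) (?P (t + n)) (comb_seq t h)" .
  qed
  also have "\<dots> = distr (rollout M \<pi> s) (?P (t + n)) ?r"
    by (simp add: steps_law_add[OF s] distr_rollout_restrict[OF s])
  finally show "distr (rollout M \<pi> s) (?P (t + n)) ?r = distr (steps_law t s \<bind> ?K) (?P (t + n)) ?r" ..
qed

subsection \<open>Returns and values\<close>

lemma pred_terminal:
  "Measurable.pred (states M \<Otimes>\<^sub>M T) (\<lambda>(s, \<omega>). state_at s \<omega> n \<in> terminal M)"
proof -
  have [measurable]: "terminal M \<in> sets (states M)" using mdp by (simp add: is_mdp_def)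
  have "(\<lambda>p. state_at (fst p) (snd p) n) \<in> states M \<Otimes>\<^sub>M T \<rightarrow>\<^sub>M states M"
    using measurable_state_at_pair[of n UNIV M] by (simp add: split_beta')
  from measurable_compose[OF this, of "\<lambda>x. x \<in> terminal M" "count_space UNIV"] show ?thesis
    by (simp add: split_beta')
qed

lemma measurable_episode_length:
  "(\<lambda>(s, \<omega>). episode_length M s \<omega>) \<in> states M \<Otimes>\<^sub>M T \<rightarrow>\<^sub>M count_space UNIV"
  unfolding episode_length_def split_beta'
  by (rule measurable_Least) (use pred_terminal in \<open>simp add: split_beta'\<close>)

lemma measurable_reward_at: "(\<lambda>\<omega>. reward_at \<omega> i) \<in> borel_measurable T"
  unfolding reward_at_def step_space_def by measurable

text \<open>The number of summands is random. Splitting over the countably many values of the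
  episode length leaves finite sums of measurable rewards.\<close>

lemma measurable_total_return:
  "(\<lambda>(s, \<omega>). total_return M s \<omega>) \<in> borel_measurable (states M \<Otimes>\<^sub>M T)"
proof -
  note measurable_compose[OF measurable_snd measurable_reward_at, measurable]
  have "(\<lambda>p. (\<lambda>n p. \<Sum>i<n. discount M ^ i * reward_at (snd p) i) (case p of (s, \<omega>) \<Rightarrow> episode_length M s \<omega>) p)
      \<in> borel_measurable (states M \<Otimes>\<^sub>M T)"
    by (rule measurable_compose_countable[OF _ measurable_episode_length]) measurable
  then show ?thesis by (simp add: total_return_def split_beta')
qed

lemma measurable_return_to_go:
  assumes s: "s \<in> space (states M)"
  shows "return_to_go M s t \<in> borel_measurable T"
proof -
  note measurable_reward_at[measurable]
  have L: "episode_length M s \<in> T \<rightarrow>\<^sub>M count_space UNIV"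
    using measurable_Pair2[OF measurable_episode_length s] by simp
  have "(\<lambda>\<omega>. (\<lambda>n \<omega>. \<Sum>i\<in>{t..<n}. discount M ^ (i - t) * reward_at \<omega> i) (episode_length M s \<omega>) \<omega>)
      \<in> borel_measurable T"
    by (rule measurable_compose_countable[OF _ L]) measurable
  then show ?thesis by (simp add: return_to_go_def[abs_def])
qed

text \<open>Law and integrand both vary with \<open>s\<close>. Pushing the rollout forward along the
  return moves the whole dependence into a kernel on the real line.\<close>

lemma measurable_state_value: "state_value M \<pi> \<in> borel_measurable (states M)"
proof -
  let ?K = "\<lambda>s. distr (rollout M \<pi> s) borel (total_return M s)"
  have "?K \<in> states M \<rightarrow>\<^sub>M subprob_algebra borel"
    by (rule measurable_distr2[OF measurable_total_return measurable_prob_algebraD[OF measurable_rollout]])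
  from measurable_compose[OF this integral_measurable_subprob_algebra[of "\<lambda>x. x"]]
  have "(\<lambda>s. \<integral>x. x \<partial>?K s :: real) \<in> borel_measurable (states M)" by simp
  also have "?this \<longleftrightarrow> ?thesis"
  proof (rule measurable_cong)
    fix s assume s: "s \<in> space (states M)"
    have "total_return M s \<in> borel_measurable (rollout M \<pi> s)"
      using measurable_Pair2[OF measurable_total_return s]
      by (simp add: measurable_cong_sets[OF sets_rollout[OF s] refl])
    then show "(\<integral>x. x \<partial>?K s) = state_value M \<pi> s"
      by (simp add: integral_distr state_value_def)
  qed
  finally show ?thesis .
qed

end

text \<open>Termination makes the \<open>LEAST\<close> a genuine first visit. As it comes after
  \<open>t\<close>, the continuation started in the state at time \<open>t\<close> ends exactly
  \<open>t\<close> steps earlier, and the shift of indices by \<open>t\<close> matches rewards and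
  discounts.\<close>

lemma return_to_go_comb_seq:
  assumes T: "terminates M s (comb_seq t h \<omega>)" and t: "t < episode_length M s (comb_seq t h \<omega>)"
  shows "return_to_go M s t (comb_seq t h \<omega>) = total_return M (state_at s h t) \<omega>"
proof -
  let ?w = "comb_seq t h \<omega>"
  let ?Q = "\<lambda>n. state_at s ?w n \<in> terminal M"
  obtain n where n: "?Q n" using T by (auto simp: terminates_def)
  have Lt: "?Q (LEAST n. ?Q n)" by (rule LeastI[of ?Q, OF n])
  have "episode_length M s ?w = t + episode_length M (state_at s h t) \<omega>"
    unfolding episode_length_def
  proof (rule Least_equality)
    let ?R = "\<lambda>n. state_at (state_at s h t) \<omega> n \<in> terminal M"
    obtain m where m: "(LEAST n. ?Q n) = t + m"
      using t by (metis episode_length_def less_imp_le le_Suc_ex)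
    have "?R m" using Lt unfolding m state_at_comb_seq .
    then have "?R (LEAST n. ?R n)" by (rule LeastI)
    then show "?Q (t + (LEAST n. ?R n))" unfolding state_at_comb_seq .
    fix y assume y: "?Q y"
    then have "(LEAST n. ?Q n) \<le> y" by (rule Least_le)
    then obtain l where l: "y = t + l" using m by (metis le_iff_add add.assoc)
    have "?R l" using y unfolding l state_at_comb_seq .
    then show "t + (LEAST n. ?R n) \<le> y" using Least_le[of ?R l] l by simp
  qed
  then show ?thesis
    unfolding return_to_go_def total_return_def
    by (intro sum.reindex_bij_witness[of _ "\<lambda>i. t + i" "\<lambda>i. i - t"])
       (auto simp: reward_at_def comb_seq_def)
qed

section \<open>Comparing the sibling and trajectory-level variances\<close>

theorem theorem2:
  fixes M :: "('s, 'a) mdp" and \<pi> :: "'s \<Rightarrow> 'a measure" and s\<^sub>0 :: 's and K t k :: nat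
  assumes "is_mdp M" and "is_policy M \<pi>" and "s\<^sub>0 \<in> space (states M)"
    and episodic: "AE \<omega> in rollout M \<pi> s\<^sub>0. terminates M s\<^sub>0 \<omega>"
    and square_integrable: "integrable (rollout M \<pi> s\<^sub>0) (\<lambda>\<omega>. (total_return M s\<^sub>0 \<omega>)\<^sup>2)"
    and "K \<ge> 2" and "k \<in> {1..K}" and "t > 0"
    and branch_in_episode: "AE \<omega> in rollout M \<pi> s\<^sub>0. t < episode_length M s\<^sub>0 \<omega>"
    and sparse: "AE \<omega> in rollout M \<pi> s\<^sub>0. \<forall>i<t. reward_at \<omega> i = 0"
    and undiscounted: "discount M = 1"
  shows "prob_space.variance (bpo_law M \<pi> K t s\<^sub>0) (bpo_advantage M K t s\<^sub>0 k) =
           prob_space.variance (grpo_law M \<pi> K s\<^sub>0) (grpo_advantage M K s\<^sub>0 k) -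
           real K / (real K - 1) *
             prob_space.variance (prefix_law M \<pi> t s\<^sub>0) (\<lambda>h. state_value M \<pi> (state_at s\<^sub>0 h t)) \<and>
         prob_space.variance (bpo_law M \<pi> K t s\<^sub>0) (bpo_advantage M K t s\<^sub>0 k) \<le>
           prob_space.variance (grpo_law M \<pi> K s\<^sub>0) (grpo_advantage M K s\<^sub>0 k) \<and>
         (prob_space.variance (bpo_law M \<pi> K t s\<^sub>0) (bpo_advantage M K t s\<^sub>0 k) =
           prob_space.variance (grpo_law M \<pi> K s\<^sub>0) (grpo_advantage M K s\<^sub>0 k) \<longleftrightarrow>
           (\<exists>c. AE h in prefix_law M \<pi> t s\<^sub>0. state_value M \<pi> (state_at s\<^sub>0 h t) = c))"
proof -
  interpret mdp_policy M \<pi> by unfold_locales fact+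
  note s = \<open>s\<^sub>0 \<in> space (states M)\<close>
  let ?R = "rollout M \<pi> s\<^sub>0"
  let ?T = "\<Pi>\<^sub>M i\<in>(UNIV :: nat set). step_space M"
  define P where "P = prefix_law M \<pi> t s\<^sub>0"
  define \<kappa> where "\<kappa> h = rollout M \<pi> (state_at s\<^sub>0 h t)" for h :: "('s, 'a) trajectory"
  define Y where "Y = return_to_go M s\<^sub>0 t"
  define g where "g h \<omega> = Y (comb_seq t h \<omega>)" for h \<omega>
  define V where "V h = state_value M \<pi> (state_at s\<^sub>0 h t)" for h :: "('s, 'a) trajectory"
  define c where "c = real K / (real K - 1)"
  have c: "c > 0" using \<open>K \<ge> 2\<close> by (auto simp: c_def)
  have PS: "P = steps_law t s\<^sub>0"
    unfolding P_def prefix_law_def prefix_space_def by (rule distr_rollout_restrict[OF s])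
  have setsP: "sets P = sets (prefix_space M t)"
    unfolding PS prefix_space_def by (rule sets_steps_law[OF s])
  have P: "prob_space P" unfolding PS by (rule prob_space_steps_law[OF s])
  interpret P: prob_space P by (rule P)
  interpret R: prob_space ?R by (rule prob_space_rollout[OF s])
  note PM = measurable_cong_sets[OF setsP[unfolded prefix_space_def] refl]
  have \<kappa>: "\<kappa> \<in> P \<rightarrow>\<^sub>M prob_algebra ?T"
    unfolding PM \<kappa>_def by (rule measurable_rollout_state_at[OF s])
  have stm: "(\<lambda>h. state_at s\<^sub>0 h t) \<in> P \<rightarrow>\<^sub>M states M"
    unfolding PM by (rule measurable_state_at[OF s]) auto
  have Vm: "V \<in> borel_measurable P"
    unfolding V_def by (rule measurable_compose[OF stm measurable_state_value])
  have Ym: "Y \<in> borel_measurable ?T"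
    unfolding Y_def by (rule measurable_return_to_go[OF s])
  note RM = measurable_cong_sets[OF sets_rollout[OF s] refl]
  have YR: "Y \<in> borel_measurable ?R" using Ym by (simp only: RM)
  have fR: "total_return M s\<^sub>0 \<in> borel_measurable ?R"
    using measurable_Pair2[OF measurable_total_return s] by (simp add: RM)
  have comb: "(\<lambda>(h, \<omega>). comb_seq t h \<omega>) \<in> P \<Otimes>\<^sub>M ?T \<rightarrow>\<^sub>M ?T"
    using measurable_comb_seq_prefix[of t "step_space M"]
    by (simp only: measurable_cong_sets[OF sets_pair_measure_cong[OF setsP[unfolded prefix_space_def] refl] refl])
  have gm: "(\<lambda>(h, \<omega>). g h \<omega>) \<in> borel_measurable (P \<Otimes>\<^sub>M ?T)"
    using measurable_compose[OF comb Ym] by (simp add: g_def split_beta')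
  have ch: "comb_seq t h \<in> \<kappa> h \<rightarrow>\<^sub>M ?T" and \<kappa>h: "prob_space (\<kappa> h)" "sets (\<kappa> h) = sets ?T" if h: "h \<in> space P" for h
  proof -
    show 1: "prob_space (\<kappa> h)" "sets (\<kappa> h) = sets ?T"
      using measurable_space[OF \<kappa> h] by (auto simp: space_prob_algebra)
    show "comb_seq t h \<in> \<kappa> h \<rightarrow>\<^sub>M ?T"
      unfolding measurable_cong_sets[OF 1(2) refl] using measurable_Pair2[OF comb h] by simp
  qed
  \<comment> \<open>\<open>\<kappa>c\<close> glues prefix and continuation and mixes to the rollout
    law. Its companion \<open>\<kappa>p\<close> keeps the two apart, as the sibling law does;
    \<open>Rp\<close> says that gluing maps the second mixture to the first.\<close>
  define \<kappa>c where "\<kappa>c h = distr (\<kappa> h) ?T (comb_seq t h)" for h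
  have \<kappa>c: "\<kappa>c \<in> P \<rightarrow>\<^sub>M prob_algebra ?T"
    unfolding \<kappa>c_def by (rule measurable_distr_prob_space2[OF \<kappa> comb])
  have R: "?R = P \<bind> \<kappa>c"
    unfolding PS \<kappa>c_def \<kappa>_def by (rule rollout_Markov[OF s])
  define \<kappa>p where "\<kappa>p h = distr (\<kappa> h) (P \<Otimes>\<^sub>M ?T) (Pair h)" for h
  have \<kappa>p: "\<kappa>p \<in> P \<rightarrow>\<^sub>M prob_algebra (P \<Otimes>\<^sub>M ?T)"
    unfolding \<kappa>p_def by (rule measurable_distr_prob_space2[OF \<kappa>]) simp
  have pair: "Pair h \<in> \<kappa> h \<rightarrow>\<^sub>M P \<Otimes>\<^sub>M ?T" if "h \<in> space P" for h
    unfolding measurable_cong_sets[OF \<kappa>h(2)[OF that] refl] by (rule measurable_Pair1'[OF that])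
  have "distr (P \<bind> \<kappa>p) ?T (\<lambda>(h, \<omega>). comb_seq t h \<omega>) = P \<bind> (\<lambda>h. distr (\<kappa>p h) ?T (\<lambda>(h, \<omega>). comb_seq t h \<omega>))"
    by (rule distr_bind[OF measurable_prob_algebraD[OF \<kappa>p] P.not_empty comb])
  also have "\<dots> = P \<bind> \<kappa>c"
    by (rule bind_cong[OF refl]) (simp add: \<kappa>p_def \<kappa>c_def distr_distr[OF comb pair] comp_def)
  finally have Rp: "?R = distr (P \<bind> \<kappa>p) ?T (\<lambda>(h, \<omega>). comb_seq t h \<omega>)"
    by (simp add: R)

  \<comment> \<open>Since \<open>discount M = 1\<close>, all weights are 1 in the return and in the
    return-to-go alike. The two differ by the sum of the rewards before \<open>t\<close>, which
    vanishes.\<close>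
  have YF: "AE \<omega> in ?R. Y \<omega> = total_return M s\<^sub>0 \<omega>"
    using branch_in_episode sparse
  proof eventually_elim
    case (elim \<omega>)
    have "(\<Sum>i<episode_length M s\<^sub>0 \<omega>. reward_at \<omega> i) =
        (\<Sum>i\<in>{0..<t}. reward_at \<omega> i) + (\<Sum>i\<in>{t..<episode_length M s\<^sub>0 \<omega>}. reward_at \<omega> i)"
      using elim(1) by (subst sum.atLeastLessThan_concat) (auto simp: lessThan_atLeast0)
    then show ?case
      using elim(2) by (simp add: Y_def return_to_go_def total_return_def undiscounted)
  qed
  have Y2: "integrable ?R (\<lambda>\<omega>. (Y \<omega>)\<^sup>2)"
    using YF by (intro integrable_cong_AE[THEN iffD2, OF _ _ _ square_integrable])
      (use YR fR in auto)
  have EY: "R.expectation Y = R.expectation (total_return M s\<^sub>0)"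
    by (rule integral_cong_AE[OF YR fR YF])
  have VY: "R.variance Y = R.variance (total_return M s\<^sub>0)"
    unfolding EY using YF by (intro integral_cong_AE) (use YR fR in auto)

  \<comment> \<open>Square integrability is known for whole trajectories; \<open>Rp\<close>
    transfers it to pairs of prefix and continuation.\<close>
  have g2: "integrable (P \<bind> \<kappa>p) (\<lambda>(h, \<omega>). (g h \<omega>)\<^sup>2)"
  proof -
    have "(\<lambda>(h, \<omega>). comb_seq t h \<omega>) \<in> (P \<bind> \<kappa>p) \<rightarrow>\<^sub>M ?T"
      using comb sets_bind_measurable[OF measurable_prob_algebraD[OF \<kappa>p] P.not_empty]
      by (simp cong: measurable_cong_sets)
    from integrable_distr_eq[OF this, of "\<lambda>\<omega>. (Y \<omega>)\<^sup>2"] Y2 Ym show ?thesis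
      unfolding Rp by (simp add: g_def split_beta')
  qed
  have BPO: "prob_space.variance (bpo_law M \<pi> K t s\<^sub>0) (bpo_advantage M K t s\<^sub>0 k) =
      c * (\<integral>h. prob_space.variance (\<kappa> h) (g h) \<partial>P)"
  proof -
    have "bpo_law M \<pi> K t s\<^sub>0 = P \<bind> (\<lambda>h. distr (\<Pi>\<^sub>M j\<in>{1..K}. \<kappa> h) (P \<Otimes>\<^sub>M (\<Pi>\<^sub>M j\<in>{1..K}. ?T)) (Pair h))"
      unfolding bpo_law_def P_def[symmetric] \<kappa>_def
      by (intro bind_cong distr_cong sets_pair_measure_cong setsP[symmetric] refl)
    moreover have "bpo_advantage M K t s\<^sub>0 k = (\<lambda>(h, x). leave_one_out K (\<lambda>j. g h (x j)) k)"
      by (simp add: bpo_advantage_def g_def Y_def)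
    ultimately show ?thesis
      using branched_leave_one_out_variance[OF P \<kappa> gm g2[unfolded \<kappa>p_def[abs_def]] \<open>K \<ge> 2\<close> \<open>k \<in> {1..K}\<close>]
      by (simp add: c_def)
  qed
  have GRPO: "prob_space.variance (grpo_law M \<pi> K s\<^sub>0) (grpo_advantage M K s\<^sub>0 k) =
      c * R.variance (total_return M s\<^sub>0)"
    using leave_one_out_moments[OF R.prob_space_axioms fR square_integrable \<open>K \<ge> 2\<close> \<open>k \<in> {1..K}\<close>]
    by (simp add: grpo_law_def grpo_advantage_def[abs_def] c_def)

  \<comment> \<open>Conditioning the rollout on its prefix splits the variance of the return into
    the integral that appears in \<open>BPO\<close> and the variance of the conditional
    mean.\<close>
  note tv = law_of_total_variance[OF P \<kappa>c Ym Y2[unfolded R]]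
  have I: "(\<integral>\<omega>. F (Y \<omega>) \<partial>\<kappa>c h) = (\<integral>\<omega>. F (g h \<omega>) \<partial>\<kappa> h)"
    if "h \<in> space P" "F \<in> borel_measurable borel" for h and F :: "real \<Rightarrow> real"
    unfolding \<kappa>c_def g_def
    by (rule integral_distr[OF ch[OF that(1)] measurable_compose[OF Ym that(2)]])
  have I1: "(\<integral>\<omega>. Y \<omega> \<partial>\<kappa>c h) = (\<integral>\<omega>. g h \<omega> \<partial>\<kappa> h)" if "h \<in> space P" for h
    using I[OF that, of "\<lambda>x. x"] by simp
  have I2: "prob_space.variance (\<kappa>c h) Y = prob_space.variance (\<kappa> h) (g h)" if "h \<in> space P" for h
    using I[OF that, of "\<lambda>x. (x - (\<integral>\<omega>. g h \<omega> \<partial>\<kappa> h))\<^sup>2"] I1[OF that] by simp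
  \<comment> \<open>By \<open>AE_bind\<close>, an almost sure event of the rollout is almost sure
    under the continuation for almost every prefix. This turns the assumptions
    \<open>episodic\<close> and \<open>branch_in_episode\<close> into the hypotheses of
    \<open>return_to_go_comb_seq\<close>.\<close>
  have mV: "AE h in P. (\<integral>\<omega>. Y \<omega> \<partial>\<kappa>c h) = V h"
  proof -
    have pL: "Measurable.pred ?T (\<lambda>\<omega>. terminates M s\<^sub>0 \<omega> \<and> t < episode_length M s\<^sub>0 \<omega>)"
    proof -
      have [measurable]: "Measurable.pred ?T (\<lambda>\<omega>. state_at s\<^sub>0 \<omega> n \<in> terminal M)" for n
        using measurable_Pair2[OF pred_terminal s] by simp
      have [measurable]: "episode_length M s\<^sub>0 \<in> ?T \<rightarrow>\<^sub>M count_space UNIV"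
        using measurable_Pair2[OF measurable_episode_length s] by simp
      show ?thesis unfolding terminates_def by measurable
    qed
    have "AE \<omega> in P \<bind> \<kappa>c. terminates M s\<^sub>0 \<omega> \<and> t < episode_length M s\<^sub>0 \<omega>"
      using episodic branch_in_episode unfolding R[symmetric] by eventually_elim auto
    then have "AE h in P. AE \<omega> in \<kappa>c h. terminates M s\<^sub>0 \<omega> \<and> t < episode_length M s\<^sub>0 \<omega>"
      by (subst (asm) AE_bind[OF measurable_prob_algebraD[OF \<kappa>c] pL])
    then show ?thesis
      using AE_space
    proof eventually_elim
      case (elim h)
      have st: "state_at s\<^sub>0 h t \<in> space (states M)"
        using measurable_space[OF stm elim(2)] .
      have "AE \<omega> in \<kappa> h. terminates M s\<^sub>0 (comb_seq t h \<omega>) \<and> t < episode_length M s\<^sub>0 (comb_seq t h \<omega>)"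
        using elim(1) pL unfolding \<kappa>c_def by (subst (asm) AE_distr_iff[OF ch[OF elim(2)]]) (auto simp: pred_def)
      then have "AE \<omega> in \<kappa> h. g h \<omega> = total_return M (state_at s\<^sub>0 h t) \<omega>"
        by eventually_elim (simp add: g_def Y_def return_to_go_comb_seq)
      then have "(\<integral>\<omega>. g h \<omega> \<partial>\<kappa> h) = V h"
        unfolding V_def state_value_def \<kappa>_def[symmetric]
        using measurable_Pair2[OF measurable_total_return st] measurable_Pair2[OF gm elim(2)]
        by (intro integral_cong_AE) (auto simp: measurable_cong_sets[OF \<kappa>h(2)[OF elim(2)] refl])
      then show ?case using I1[OF elim(2)] by simp
    qed
  qed
  \<comment> \<open>The conditional mean and \<open>V\<close> are known to agree only almost
    everywhere, so integrability and variance are carried over by almost-everywhere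
    congruence.\<close>
  have mm: "(\<lambda>h. \<integral>\<omega>. Y \<omega> \<partial>\<kappa>c h) \<in> borel_measurable P" using tv(2) by auto
  have V1: "integrable P V"
    using integrable_cong_AE[OF mm Vm mV] tv(2) by simp
  have V2: "integrable P (\<lambda>h. (V h)\<^sup>2)"
    using mV mm Vm by (intro integrable_cong_AE[THEN iffD1, OF _ _ _ tv(3)]) auto
  have EV: "P.expectation (\<lambda>h. \<integral>\<omega>. Y \<omega> \<partial>\<kappa>c h) = P.expectation V"
    by (rule integral_cong_AE[OF mm Vm mV])
  have VV: "P.variance (\<lambda>h. \<integral>\<omega>. Y \<omega> \<partial>\<kappa>c h) = P.variance V"
    unfolding EV using mV mm Vm by (intro integral_cong_AE) auto
  have "R.variance Y = (\<integral>h. prob_space.variance (\<kappa> h) (g h) \<partial>P) + P.variance V"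
    using tv(5) VV I2 unfolding R[symmetric] by (simp cong: Bochner_Integration.integral_cong)
  then have main: "c * (\<integral>h. prob_space.variance (\<kappa> h) (g h) \<partial>P) =
      c * R.variance (total_return M s\<^sub>0) - c * P.variance V"
    unfolding VY[symmetric] by (simp add: algebra_simps)
  have nonneg: "0 \<le> c * P.variance V"
    using c P.variance_positive[of V] by (intro mult_nonneg_nonneg) auto
  have zero: "c * P.variance V = 0 \<longleftrightarrow> (\<exists>d. AE h in P. V h = d)"
    using c P.variance_zero_iff_AE_const[OF V1 V2] by simp
  show ?thesis
    \<comment> \<open>Once constancy of the value is expressed as
      \<open>c * P.variance V = 0\<close>, all three claims are linear facts about the nonnegative
      number \<open>c * P.variance V\<close>.\<close>
    unfolding BPO GRPO P_def[symmetric] V_def[symmetric] c_def[symmetric] zero[symmetric]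
    using main nonneg by linarith
qed

end
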